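(* For every fixed positive integer $p$, there is a polynomial-time algorithm which, given a flow network ${\cal N}=(D,s,t,c)$, outputs an $(s,t)$-flow that is the sum of at most $p$ path-flows along pairwise arc-disjoint paths, with value at least $\frac{1}{H(p)}$ times the maximum value of such a flow; and likewise there is a polynomial-time algorithm achieving ratio $\frac{1}{H(p)}$ for flows that are the sum of at most $p$ path-flows along pairwise internally vertex-disjoint paths. Here $H(p)=\sum_{i=1}^p\frac{1}{i}$.
   Context: A flow network ${\cal N}=(D,s,t,c)$ consists of a digraph $D$, a source $s$, a sink $t$ and non-negative integer arc capacities $c$. All flows are integer valued: an $(s,t)$-flow $x$ assigns to each arc $uv$ an integer $0\le x(uv)\le c(uv)$ with flow conservation at every vertex other than $s,t$; its value is the net amount leaving $s$. A path-flow along a directed $(s,t)$-path $P$ is a flow with $x(uv)=r$ on all arcs of $P$ (for some integer $r$) and $0$ elsewhere. Internally vertex-disjoint paths share only the vertices $s$ and $t$. *)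

theory Defs
  imports
    "Graph_Theory.Pair_Digraph"
    "HOL-Analysis.Harmonic_Numbers"
    "HOL-Computational_Algebra.Polynomial"
    "HOL-Library.Log_Nat"
begin

section \<open>Flow networks\<close>

record 'a flow_network =
  graph_of :: "'a pair_pre_digraph"
  src :: 'a
  snk :: 'a
  capacity :: "'a \<times> 'a \<Rightarrow> nat"

definition flow_network :: "'a flow_network \<Rightarrow> bool" where
  "flow_network N \<longleftrightarrow>
     pair_digraph (graph_of N) \<and>
     src N \<in> pverts (graph_of N) \<and> snk N \<in> pverts (graph_of N) \<and> src N \<noteq> snk N"

text \<open>Only the values of a flow on the arcs matter here. The flows built from path-flows below
  are zero on all other pairs.\<close>

definition st_flow :: "'a flow_network \<Rightarrow> ('a \<times> 'a \<Rightarrow> nat) \<Rightarrow> bool" where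
  "st_flow N x \<longleftrightarrow>
     (\<forall>a \<in> parcs (graph_of N). x a \<le> capacity N a) \<and>
     (\<forall>v \<in> pverts (graph_of N) - {src N, snk N}.
        (\<Sum>a \<in> in_arcs (graph_of N) v. x a) = (\<Sum>a \<in> out_arcs (graph_of N) v. x a))"

definition flow_value :: "'a flow_network \<Rightarrow> ('a \<times> 'a \<Rightarrow> nat) \<Rightarrow> int" where
  "flow_value N x =
     int (\<Sum>a \<in> out_arcs (graph_of N) (src N). x a) - int (\<Sum>a \<in> in_arcs (graph_of N) (src N). x a)"

definition st_path :: "'a flow_network \<Rightarrow> ('a \<times> 'a) list \<Rightarrow> bool" where
  "st_path N P \<longleftrightarrow> pre_digraph.apath (graph_of N) (src N) P (snk N)"

definition path_flow :: "'a flow_network \<Rightarrow> ('a \<times> 'a) list \<Rightarrow> ('a \<times> 'a \<Rightarrow> nat) \<Rightarrow> bool" where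
  "path_flow N P x \<longleftrightarrow>
     st_path N P \<and> st_flow N x \<and> (\<exists>r. \<forall>a. x a = (if a \<in> set P then r else 0))"

definition arc_disjoint :: "'a flow_network \<Rightarrow> ('a \<times> 'a) list \<Rightarrow> ('a \<times> 'a) list \<Rightarrow> bool" where
  "arc_disjoint N P Q \<longleftrightarrow> set P \<inter> set Q = {}"

definition internally_disjoint :: "'a flow_network \<Rightarrow> ('a \<times> 'a) list \<Rightarrow> ('a \<times> 'a) list \<Rightarrow> bool" where
  "internally_disjoint N P Q \<longleftrightarrow>
     set (pre_digraph.awalk_verts (graph_of N) (src N) P) \<inter>
     set (pre_digraph.awalk_verts (graph_of N) (src N) Q) = {src N, snk N}"

definition sum_of_path_flows ::
  "('a flow_network \<Rightarrow> ('a \<times> 'a) list \<Rightarrow> ('a \<times> 'a) list \<Rightarrow> bool) \<Rightarrow> nat \<Rightarrow>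
   'a flow_network \<Rightarrow> ('a \<times> 'a \<Rightarrow> nat) \<Rightarrow> bool" where
  "sum_of_path_flows sep p N x \<longleftrightarrow>
     st_flow N x \<and>
     (\<exists>\<P> f. finite \<P> \<and> card \<P> \<le> p \<and> pairwise (sep N) \<P> \<and>
        (\<forall>P \<in> \<P>. path_flow N P (f P)) \<and> x = (\<lambda>a. \<Sum>P \<in> \<P>. f P a))"

definition max_flow_value ::
  "('a flow_network \<Rightarrow> ('a \<times> 'a \<Rightarrow> nat) \<Rightarrow> bool) \<Rightarrow> 'a flow_network \<Rightarrow> int" where
  "max_flow_value feasible N = Max {flow_value N x | x. feasible N x}"

text \<open>The maximum is taken over a finite nonempty set.\<close>

lemma sum_of_path_flows_values:
  assumes "flow_network N"
  shows "finite {flow_value N x | x. sum_of_path_flows sep p N x}"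
    and "{flow_value N x | x. sum_of_path_flows sep p N x} \<noteq> {}"
proof -
  interpret pair_digraph "graph_of N" using assms by (simp add: flow_network_def)
  let ?G = "with_proj (graph_of N)"
  let ?C = "\<Sum>a \<in> parcs (graph_of N). capacity N a"
  have "flow_value N x \<in> {- int ?C .. int ?C}" if "st_flow N x" for x
  proof -
    have le: "(\<Sum>a \<in> B. x a) \<le> ?C" if "B \<subseteq> parcs (graph_of N)" for B
    proof -
      have "(\<Sum>a \<in> B. x a) \<le> (\<Sum>a \<in> B. capacity N a)"
        using that \<open>st_flow N x\<close> by (intro sum_mono) (auto simp: st_flow_def)
      also have "\<dots> \<le> ?C"
        using that pair_finite_arcs by (intro sum_mono2) auto
      finally show ?thesis .
    qed
    have "(\<Sum>a \<in> out_arcs ?G (src N). x a) \<le> ?C" "(\<Sum>a \<in> in_arcs ?G (src N). x a) \<le> ?C"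
      by (auto intro!: le simp: out_arcs_def in_arcs_def)
    then show ?thesis unfolding flow_value_def atLeastAtMost_iff by linarith
  qed
  then have "{flow_value N x | x. sum_of_path_flows sep p N x} \<subseteq> {- int ?C .. int ?C}"
    unfolding sum_of_path_flows_def by blast
  then show "finite {flow_value N x | x. sum_of_path_flows sep p N x}"
    by (rule finite_subset) simp
  have "sum_of_path_flows sep p N (\<lambda>_. 0)"
    unfolding sum_of_path_flows_def by (auto simp: st_flow_def intro!: exI[of _ "{}"])
  then show "{flow_value N x | x. sum_of_path_flows sep p N x} \<noteq> {}" by blast
qed


section \<open>Polynomial-time computation\<close>

text \<open>
  The machine model is a random access machine over the natural numbers, programmed by structured
  programs. The memory consists of unbounded arrays, addressed by name; a scalar variable is cell 0
  of an array. Every elementary operation costs one time unit. As the only arithmetic operations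
  are addition and truncated subtraction, the lengths of the numbers grow by a constant (depending
  on the program) in each step, so that unit-cost polynomial time coincides with polynomial time
  on Turing machines (Cook and Reckhow). Multiplication must therefore not be added as a primitive.
\<close>

type_synonym memory = "string \<Rightarrow> nat \<Rightarrow> nat"

datatype expr =
    Num nat
  | Cell string expr
  | Add expr expr
  | Sub expr expr

primrec eval_expr :: "expr \<Rightarrow> memory \<Rightarrow> nat" where
  "eval_expr (Num n) \<sigma> = n"
| "eval_expr (Cell A e) \<sigma> = \<sigma> A (eval_expr e \<sigma>)"
| "eval_expr (Add e e') \<sigma> = eval_expr e \<sigma> + eval_expr e' \<sigma>"
| "eval_expr (Sub e e') \<sigma> = eval_expr e \<sigma> - eval_expr e' \<sigma>"

primrec expr_cost :: "expr \<Rightarrow> nat" where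
  "expr_cost (Num n) = 1"
| "expr_cost (Cell A e) = expr_cost e + 1"
| "expr_cost (Add e e') = expr_cost e + expr_cost e' + 1"
| "expr_cost (Sub e e') = expr_cost e + expr_cost e' + 1"

text \<open>\<open>Assign A i e\<close> is the assignment \<open>A[i] := e\<close>; the tests of \<open>Cond\<close> and \<open>While\<close> succeed on
  nonzero values.\<close>

datatype program =
    Skip
  | Assign string expr expr
  | Seq program program
  | Cond expr program program
  | While expr program

text \<open>\<open>exec c \<sigma> t \<tau>\<close>: started in memory \<open>\<sigma>\<close>, the program \<open>c\<close> terminates after \<open>t\<close> time units in
  memory \<open>\<tau>\<close>.\<close>

inductive exec :: "program \<Rightarrow> memory \<Rightarrow> nat \<Rightarrow> memory \<Rightarrow> bool" where
  Skip: "exec Skip \<sigma> 1 \<sigma>"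
| Assign: "exec (Assign A i e) \<sigma> (expr_cost i + expr_cost e + 1)
    (\<sigma>(A := (\<sigma> A)(eval_expr i \<sigma> := eval_expr e \<sigma>)))"
| Seq: "exec c \<sigma> t \<sigma>' \<Longrightarrow> exec d \<sigma>' t' \<tau> \<Longrightarrow> exec (Seq c d) \<sigma> (t + t') \<tau>"
| CondTrue: "eval_expr b \<sigma> \<noteq> 0 \<Longrightarrow> exec c \<sigma> t \<tau> \<Longrightarrow> exec (Cond b c d) \<sigma> (expr_cost b + 1 + t) \<tau>"
| CondFalse: "eval_expr b \<sigma> = 0 \<Longrightarrow> exec d \<sigma> t \<tau> \<Longrightarrow> exec (Cond b c d) \<sigma> (expr_cost b + 1 + t) \<tau>"
| WhileFalse: "eval_expr b \<sigma> = 0 \<Longrightarrow> exec (While b c) \<sigma> (expr_cost b + 1) \<sigma>"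
| WhileTrue: "eval_expr b \<sigma> \<noteq> 0 \<Longrightarrow> exec c \<sigma> t \<sigma>' \<Longrightarrow> exec (While b c) \<sigma>' t' \<tau> \<Longrightarrow>
    exec (While b c) \<sigma> (expr_cost b + 1 + t + t') \<tau>"

inductive_cases exec_SkipE: "exec Skip \<sigma> t \<tau>"
inductive_cases exec_AssignE: "exec (Assign A i e) \<sigma> t \<tau>"
inductive_cases exec_SeqE: "exec (Seq c d) \<sigma> t \<tau>"
inductive_cases exec_CondE: "exec (Cond b c d) \<sigma> t \<tau>"
inductive_cases exec_WhileE: "exec (While b c) \<sigma> t \<tau>"

lemma exec_deterministic:
  assumes "exec c \<sigma> t \<tau>" and "exec c \<sigma> t' \<tau>'"
  shows "t' = t \<and> \<tau>' = \<tau>"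
  using assms
proof (induction arbitrary: t' \<tau>' rule: exec.induct)
  case Skip
  then show ?case by (auto elim: exec_SkipE)
next
  case Assign
  then show ?case by (auto elim: exec_AssignE)
next
  case (Seq c \<sigma> t \<sigma>' d u \<tau>)
  from Seq.prems obtain t1 \<sigma>1 t2
    where 1: "exec c \<sigma> t1 \<sigma>1" and 2: "exec d \<sigma>1 t2 \<tau>'" and t': "t' = t1 + t2"
    by (rule exec_SeqE)
  from Seq.IH(1)[OF 1] have "t1 = t" "\<sigma>1 = \<sigma>'" by auto
  with Seq.IH(2)[of t2 \<tau>'] 2 t' show ?case by simp
next
  case (CondTrue b \<sigma> c t \<tau> d)
  obtain t1
    where 1: "exec c \<sigma> t1 \<tau>'" and t': "t' = expr_cost b + 1 + t1"
    by (rule exec_CondE[OF CondTrue.prems]) (use CondTrue.hyps(1) in auto)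
  from CondTrue.IH[OF 1] t' show ?case by simp
next
  case (CondFalse b \<sigma> d t \<tau> c)
  obtain t1
    where 1: "exec d \<sigma> t1 \<tau>'" and t': "t' = expr_cost b + 1 + t1"
    by (rule exec_CondE[OF CondFalse.prems]) (use CondFalse.hyps(1) in auto)
  from CondFalse.IH[OF 1] t' show ?case by simp
next
  case (WhileFalse b \<sigma> c)
  from WhileFalse.prems show ?case by (rule exec_WhileE) (use WhileFalse.hyps in simp_all)
next
  case (WhileTrue b \<sigma> c t \<sigma>' u \<tau>)
  obtain t1 \<sigma>1 t2
    where 1: "exec c \<sigma> t1 \<sigma>1" and 2: "exec (While b c) \<sigma>1 t2 \<tau>'"
      and t': "t' = expr_cost b + 1 + t1 + t2"
    by (rule exec_WhileE[OF WhileTrue.prems]) (use WhileTrue.hyps(1) in auto)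
  from WhileTrue.IH(1)[OF 1] have "t1 = t" "\<sigma>1 = \<sigma>'" by auto
  with WhileTrue.IH(2)[of t2 \<tau>'] 2 t' show ?case by simp
qed

definition initial_memory :: "nat list \<Rightarrow> memory" where
  "initial_memory w =
     (\<lambda>_ _. 0)(''in'' := (\<lambda>i. if i < length w then w ! i else 0),
               ''inlen'' := (\<lambda>_. 0)(0 := length w))"

definition output_of :: "memory \<Rightarrow> nat list" where
  "output_of \<sigma> = map (\<sigma> ''out'') [0..<\<sigma> ''outlen'' 0]"

text \<open>The time includes one unit per output number, as a program can set the output length to a
  large value in a single step.\<close>

definition computes_in_time :: "program \<Rightarrow> nat list \<Rightarrow> nat \<Rightarrow> nat list \<Rightarrow> bool" where
  "computes_in_time prog w T y \<longleftrightarrow>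
     (\<exists>t \<sigma>. exec prog (initial_memory w) t \<sigma> \<and> y = output_of \<sigma> \<and> T = t + length y)"

text \<open>Numbers are measured in binary; each has one additional separator.\<close>

definition input_size :: "nat list \<Rightarrow> nat" where
  "input_size w = (\<Sum>n\<leftarrow>w. floorlog 2 n + 1)"


section \<open>Approximation algorithms for networks\<close>

text \<open>A network with vertices in the natural numbers is presented by listing its vertices \<open>vs\<close> and
  its arcs \<open>as\<close>, each without repetition, in an arbitrary order.\<close>

definition network_listing ::
  "nat flow_network \<Rightarrow> nat list \<Rightarrow> (nat \<times> nat) list \<Rightarrow> bool" where
  "network_listing N vs as \<longleftrightarrow>
     distinct vs \<and> set vs = pverts (graph_of N) \<and>
     distinct as \<and> set as = parcs (graph_of N)"

definition encode_network ::
  "nat flow_network \<Rightarrow> nat list \<Rightarrow> (nat \<times> nat) list \<Rightarrow> nat list" where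
  "encode_network N vs as =
     [length vs, length as, src N, snk N] @ vs @
     concat (map (\<lambda>a. [fst a, snd a, capacity N a]) as)"

text \<open>The output is the list of the flow values on the arcs, in the order of the input.\<close>

definition poly_time_approximation ::
  "real \<Rightarrow> (nat flow_network \<Rightarrow> (nat \<times> nat \<Rightarrow> nat) \<Rightarrow> bool) \<Rightarrow> program \<Rightarrow> bool" where
  "poly_time_approximation \<rho> feasible prog \<longleftrightarrow>
     (\<exists>q :: nat poly. \<forall>N vs as. flow_network N \<and> network_listing N vs as \<longrightarrow>
        (\<exists>T x. computes_in_time prog (encode_network N vs as) T (map x as) \<and>
               T \<le> poly q (input_size (encode_network N vs as)) \<and>
               feasible N x \<and>
               real_of_int (flow_value N x) \<ge> \<rho> * real_of_int (max_flow_value feasible N)))"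

end

theory Submission
  imports Defs
begin

text \<open>If the path values of an optimal flow are \<open>v\<^sub>1 \<ge> v\<^sub>2 \<ge> \<dots>\<close>, then there are \<open>i\<close> disjoint paths
  of capacity at least \<open>v\<^sub>i\<close>, so the best value \<open>b\<close> of a flow consisting of \<open>i \<le> p\<close> disjoint paths that
  all carry the same amount satisfies \<open>v\<^sub>i \<le> b / i\<close>, and the optimum is at most \<open>H(p) b\<close>.

  To find \<open>b\<close>, try every \<open>i \<le> p\<close> and every arc capacity \<open>r\<close>, keeping only the arcs of capacity at
  least \<open>r\<close>. As \<open>p\<close> is fixed, one can afford to search for a cut of fewer than \<open>i\<close> elements by trying
  all of them and testing reachability. If there is none, delete arcs greedily as long as no such cut
  appears. By Menger's theorem the remaining arcs contain \<open>i\<close> disjoint paths, and by minimality they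
  are exactly the arcs of these paths, so no path decomposition is needed.

  Both notions of disjointness are handled at once by a key for each arc, such that paths are disjoint
  iff they use no common key, and a cut is a set of keys. For arc-disjoint paths every arc has its own
  key. For internally disjoint paths the key of an arc is its head, except that the arcs into the sink
  have their own keys. In both cases the key determines the head of an arc, so a walk in the graph of
  keys lifts to the network.\<close>

section \<open>Menger's theorem\<close>

text \<open>Only arc capacities have to be tried as the common amount: if disjoint paths all carry
  \<open>r\<close>, the amount can be raised to the least capacity on their arcs. So the number of
  steps depends on the number of arcs alone and not on the size of the capacities. Menger's theorem
  is needed only for vertices. It is applied to a graph whose vertices are the keys, two keys being
  joined if they belong to consecutive arcs; both kinds of disjointness become vertex-disjointness
  there. The obstacle is that arcs with the same key may have different tails, so a walk of keys
  does not name a walk of arcs. Equal heads are just enough for reachability inside the set of arcs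
  that carry a key of the walk, and a path inside this set uses no foreign key. The arcs into the
  sink cannot share a key, since that single key would then be a cut. The program works with
  \<open>k = i - 1\<close>, the number of nested loops that remove keys. This depth is the exponent
  in the running time, which is why a separate program is built for each \<open>p\<close>.\<close>

definition path_between :: "('b \<times> 'b) set \<Rightarrow> 'b set \<Rightarrow> 'b set \<Rightarrow> 'b list \<Rightarrow> bool" where
  "path_between E A B p \<longleftrightarrow>
     p \<noteq> [] \<and> hd p \<in> A \<and> last p \<in> B \<and> successively (\<lambda>x y. (x, y) \<in> E) p"

text \<open>The walks may repeat vertices, and a single vertex of \<open>A \<inter> B\<close> is a
  walk; hence every separator contains \<open>A \<inter> B\<close>.\<close>

definition separates :: "('b \<times> 'b) set \<Rightarrow> 'b set \<Rightarrow> 'b set \<Rightarrow> 'b set \<Rightarrow> bool" where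
  "separates E A B X \<longleftrightarrow> (\<forall>p. path_between E A B p \<longrightarrow> set p \<inter> X \<noteq> {})"

lemma path_between_empty_iff:
  "path_between {} A B p \<longleftrightarrow> (\<exists>a \<in> A \<inter> B. p = [a])"
  by (cases p rule: remdups_adj.cases) (auto simp: path_between_def)

lemma path_between_mono:
  assumes "path_between E A B p" "E \<subseteq> E'"
  shows "path_between E' A B p"
  using assms by (auto simp: path_between_def elim!: successively_mono)

lemma path_between_rev: "path_between (E\<inverse>) B A (rev p) \<longleftrightarrow> path_between E A B p"
  by (auto simp: path_between_def hd_rev last_rev)

lemma separates_converse: "separates (E\<inverse>) B A X \<longleftrightarrow> separates E A B X"
  unfolding separates_def
  by (metis path_between_rev rev_rev_ident set_rev converse_converse)

text \<open>The arc \<open>(a, b)\<close> can be used only at an occurrence of \<open>a\<close> that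
  has a successor, so an occurrence at the end of the walk is harmless.\<close>

lemma successively_restrict:
  assumes "successively (\<lambda>x y. (x, y) \<in> insert (a, b) F) p" "a \<notin> set (butlast p)"
  shows "successively (\<lambda>x y. (x, y) \<in> F) p"
  using assms by (induction p rule: induct_list012) (auto split: if_splits)

lemma path_between_restrict:
  assumes "path_between (insert (a, b) F) A B p" "a \<notin> set (butlast p)"
  shows "path_between F A B p"
  using assms successively_restrict by (fastforce simp: path_between_def)

lemma path_between_prefix:
  assumes "path_between E A B (u @ z # w)"
  shows "path_between E A {z} (u @ [z])"
  using assms by (auto simp: path_between_def successively_append_iff hd_append split: if_splits)

text \<open>A walk that avoids \<open>x\<close> cannot use the new arc; it lies in \<open>F\<close>
  and therefore meets \<open>S\<close>.\<close>

lemma separates_insert_tail: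
  assumes "separates F A B S"
  shows "separates (insert (x, y) F) A B (insert x S)"
  unfolding separates_def
proof (intro allI impI)
  fix p assume p: "path_between (insert (x, y) F) A B p"
  show "set p \<inter> insert x S \<noteq> {}"
  proof (cases "x \<in> set p")
    case False
    then have "path_between F A B p"
      using path_between_restrict[OF p] by (auto dest: in_set_butlastD)
    then show ?thesis using assms by (auto simp: separates_def)
  qed auto
qed

text \<open>Cut a walk at its first vertex in \<open>X\<close>. As \<open>x\<close> is in
  \<open>X\<close>, the initial part never leaves \<open>x\<close>; so it lies in \<open>F\<close>,
  leads to \<open>X\<close>, and has to meet \<open>Z\<close>.\<close>

lemma separates_through_tail:
  assumes "separates (insert (x, y) F) A B X" "x \<in> X" "separates F A X Z"
  shows "separates (insert (x, y) F) A B Z"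
  unfolding separates_def
proof (intro allI impI)
  fix p assume p: "path_between (insert (x, y) F) A B p"
  then have "\<exists>z \<in> set p. z \<in> X" using assms(1) by (auto simp: separates_def)
  then obtain u z w where uzw: "p = u @ z # w" "z \<in> X" "\<forall>v \<in> set u. v \<notin> X"
    by (elim split_list_first_propE) blast
  have "path_between (insert (x, y) F) A {z} (u @ [z])"
    using p unfolding uzw(1) by (rule path_between_prefix)
  then have "path_between F A {z} (u @ [z])"
    by (rule path_between_restrict) (use uzw assms(2) in auto)
  then have "path_between F A X (u @ [z])"
    using uzw by (auto simp: path_between_def)
  then show "set p \<inter> Z \<noteq> {}"
    using assms(3) uzw(1) by (fastforce simp: separates_def)
qed

section \<open>Systems of disjoint walks\<close>

definition path_system :: "('b \<times> 'b) set \<Rightarrow> 'b set \<Rightarrow> 'b set \<Rightarrow> 'b list set \<Rightarrow> bool" where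
  "path_system E A B \<P> \<longleftrightarrow>
     (\<forall>p \<in> \<P>. path_between E A B p) \<and> pairwise (\<lambda>p q. set p \<inter> set q = {}) \<P>"

text \<open>Cutting each walk at its first vertex in \<open>X\<close> maps the disjoint walks
  injectively into \<open>X\<close>. As the cardinalities agree this is a bijection, so the walks
  can be indexed by their ends, and each meets \<open>X\<close> only there.\<close>

lemma path_system_into:
  assumes fam: "path_system F A X \<P>" and fin: "finite X" and card: "card \<P> = card X"
  shows "\<exists>u. \<forall>z \<in> X. path_between F A {z} (u z @ [z]) \<and> set (u z) \<inter> X = {} \<and>
           (\<forall>z' \<in> X. z \<noteq> z' \<longrightarrow> set (u z @ [z]) \<inter> set (u z' @ [z']) = {})"
proof -
  have ex: "\<exists>u z. z \<in> X \<and> set u \<inter> X = {} \<and> path_between F A {z} (u @ [z]) \<and> set (u @ [z]) \<subseteq> set p"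
    if "p \<in> \<P>" for p
  proof -
    have p: "path_between F A X p" using fam that by (auto simp: path_system_def)
    then have "\<exists>z \<in> set p. z \<in> X" by (auto simp: path_between_def intro!: bexI[of _ "last p"])
    then obtain u z w where uzw: "p = u @ z # w" "z \<in> X" "\<forall>v \<in> set u. v \<notin> X"
      by (elim split_list_first_propE) blast
    have "path_between F A {z} (u @ [z])"
      using p unfolding uzw(1) by (rule path_between_prefix)
    then show ?thesis using uzw by (intro exI[of _ u] exI[of _ z]) auto
  qed
  obtain u e where ue: "\<And>p. p \<in> \<P> \<Longrightarrow> e p \<in> X \<and> set (u p) \<inter> X = {} \<and>
      path_between F A {e p} (u p @ [e p]) \<and> set (u p @ [e p]) \<subseteq> set p"
    using ex by metis
  have "inj_on e \<P>"
  proof (rule inj_onI, rule ccontr)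
    fix p q assume pq: "p \<in> \<P>" "q \<in> \<P>" "e p = e q" "p \<noteq> q"
    then have "set p \<inter> set q = {}" using fam by (auto simp: path_system_def pairwise_def)
    then show False using ue[OF pq(1)] ue[OF pq(2)] pq(3) by auto
  qed
  moreover have "e ` \<P> \<subseteq> X" using ue by auto
  ultimately have "e ` \<P> = X" using card fin by (metis card_image card_subset_eq)
  moreover define g where "g = inv_into \<P> e"
  ultimately have g: "g z \<in> \<P> \<and> e (g z) = z" if "z \<in> X" for z
    using that by (simp add: inv_into_into f_inv_into_f)
  show ?thesis
  proof (intro exI[of _ "\<lambda>z. u (g z)"] ballI conjI impI)
    fix z assume z: "z \<in> X"
    show "path_between F A {z} (u (g z) @ [z])" "set (u (g z)) \<inter> X = {}"
      using g[OF z] ue[of "g z"] by auto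
    fix z' assume z': "z' \<in> X" "z \<noteq> z'"
    then have "g z \<noteq> g z'" using g z by metis
    then have "set (g z) \<inter> set (g z') = {}"
      using fam g z z' by (auto simp: path_system_def pairwise_def)
    then show "set (u (g z) @ [z]) \<inter> set (u (g z') @ [z']) = {}"
      using g[OF z] g[OF z'(1)] ue[of "g z"] ue[of "g z'"] by auto
  qed
qed

lemma path_system_rev:
  assumes "path_system E A B \<P>"
  shows "path_system (E\<inverse>) B A (rev ` \<P>)"
  using assms by (auto simp: path_system_def path_between_rev pairwise_def)

text \<open>The mirror image of \<open>path_system_into\<close>, obtained by reversing all arcs and
  walks.\<close>

lemma path_system_from:
  assumes fam: "path_system F Y B \<P>" and fin: "finite Y" and card: "card \<P> = card Y"
  shows "\<exists>u. \<forall>z \<in> Y. path_between F {z} B (z # u z) \<and> set (u z) \<inter> Y = {} \<and>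
           (\<forall>z' \<in> Y. z \<noteq> z' \<longrightarrow> set (z # u z) \<inter> set (z' # u z') = {})"
proof -
  have "card (rev ` \<P>) = card Y" using card by (simp add: card_image)
  from path_system_into[OF path_system_rev[OF fam] fin this]
  obtain u where u: "\<forall>z \<in> Y. path_between (F\<inverse>) B {z} (u z @ [z]) \<and> set (u z) \<inter> Y = {} \<and>
           (\<forall>z' \<in> Y. z \<noteq> z' \<longrightarrow> set (u z @ [z]) \<inter> set (u z' @ [z']) = {})" ..
  have "path_between (F\<inverse>) B {z} (u z @ [z]) \<longleftrightarrow> path_between F {z} B (z # rev (u z))" for z
    using path_between_rev[of F B "{z}" "z # rev (u z)"] by simp
  then show ?thesis using u by (intro exI[of _ "\<lambda>z. rev (u z)"]) simp
qed

lemma path_between_join: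
  assumes "path_between F A {v} (p @ [v])" "path_between F {v} B (v # q)"
  shows "path_between F A B (p @ v # q)"
  using assms by (auto simp: path_between_def successively_append_iff hd_append split: if_splits)

text \<open>Goering's proof: delete an arc \<open>(x, y)\<close>; if this creates a smaller separator \<open>S\<close>, then
  paths from \<open>A\<close> to \<open>S \<union> {x}\<close> and from \<open>S \<union> {y}\<close> to \<open>B\<close> can be glued along \<open>S\<close> and \<open>(x, y)\<close>.\<close>

theorem menger:
  assumes "finite E" "finite A"
    and "\<And>X. finite X \<Longrightarrow> separates E A B X \<Longrightarrow> k \<le> card X"
  shows "\<exists>\<P>. finite \<P> \<and> card \<P> = k \<and> path_system E A B \<P>"
proof (cases "k = 0")
  case True
  then show ?thesis by (intro exI[of _ "{}"]) (simp add: path_system_def)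
next
  case False
  show ?thesis using assms(1) False assms(2,3)
  proof (induction E arbitrary: A B rule: finite_induct)
    case empty
    have "separates {} A B (A \<inter> B)" by (auto simp: separates_def path_between_empty_iff)
    then have "k \<le> card (A \<inter> B)" using empty by auto
    then obtain C where C: "C \<subseteq> A \<inter> B" "card C = k" "finite C"
      by (meson obtain_subset_with_card_n)
    then show ?case
      by (intro exI[of _ "(\<lambda>a. [a]) ` C"])
         (auto simp: card_image inj_on_def path_system_def path_between_empty_iff pairwise_def)
  next
    case (insert e F)
    obtain x y where e: "e = (x, y)" by fastforce
    let ?E = "insert (x, y) F"
    have big: "k \<le> card X" if "finite X" "separates ?E A B X" for X
      using insert.prems(3) that e by blast
    show ?case
    proof (cases "\<forall>X. finite X \<and> separates F A B X \<longrightarrow> k \<le> card X")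
      case True
      then obtain \<P> where "finite \<P>" "card \<P> = k" "path_system F A B \<P>"
        using insert.IH[OF insert.prems(1,2), of B] by auto
      moreover have "path_between (insert e F) A B p" if "p \<in> \<P>" for p
        using that calculation(3) by (auto simp: path_system_def intro: path_between_mono)
      ultimately show ?thesis by (intro exI[of _ \<P>]) (simp add: path_system_def)
    next
      case False
      then obtain S where S: "finite S" "separates F A B S" "card S < k" by force
      let ?X = "insert x S" and ?Y = "insert y S"
      have sX: "separates ?E A B ?X" by (rule separates_insert_tail) fact
      have conv: "?E\<inverse> = insert (y, x) (F\<inverse>)" by auto
      have "separates (F\<inverse>) B A S" using S(2) by (simp add: separates_converse)
      then have "separates (?E\<inverse>) B A ?Y" unfolding conv by (rule separates_insert_tail)
      then have sY: "separates ?E A B ?Y" by (simp only: separates_converse)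
      \<comment> \<open>\<open>?X\<close> and \<open>?Y\<close> separate in the full graph and so
        have at least \<open>k\<close> elements, while \<open>S\<close> has fewer. Hence both have
        exactly \<open>k\<close>, and \<open>x\<close> and \<open>y\<close> lie outside
        \<open>S\<close>.\<close>
      have xS: "x \<notin> S" "card ?X = k"
        using big[OF _ sX] S by (auto simp: card_insert_if split: if_splits)
      have yS: "y \<notin> S" "card ?Y = k"
        using big[OF _ sY] S by (auto simp: card_insert_if split: if_splits)
      \<comment> \<open>A set separating \<open>A\<close> from \<open>?X\<close> in \<open>F\<close>
        separates \<open>A\<close> from \<open>B\<close> in the full graph, so the induction
        hypothesis applies with \<open>?X\<close> as target. Reversal gives the same for
        \<open>?Y\<close> as source.\<close>
      have "k \<le> card Z" if "finite Z" "separates F A ?X Z" for Z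
        using big that separates_through_tail[OF sX] by auto
      then obtain \<P> where P: "card \<P> = k" "path_system F A ?X \<P>"
        using insert.IH[OF insert.prems(1,2), of ?X] by auto
      have "k \<le> card Z" if Z: "finite Z" "separates F ?Y B Z" for Z
      proof -
        have "separates (F\<inverse>) B ?Y Z" using Z by (simp only: separates_converse)
        then have "separates (?E\<inverse>) B A Z"
          using separates_through_tail[of y x "F\<inverse>" B A ?Y Z] sY unfolding conv[symmetric]
          by (simp only: separates_converse) simp
        then show ?thesis using big Z(1) by (simp only: separates_converse)
      qed
      then obtain \<Q> where Q: "card \<Q> = k" "path_system F ?Y B \<Q>"
        using insert.IH[of ?Y B] insert.prems(1) S(1) by auto
      obtain u where u: "\<And>z. z \<in> ?X \<Longrightarrow> path_between F A {z} (u z @ [z]) \<and> set (u z) \<inter> ?X = {}"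
        "\<And>z z'. z \<in> ?X \<Longrightarrow> z' \<in> ?X \<Longrightarrow> z \<noteq> z' \<Longrightarrow> set (u z @ [z]) \<inter> set (u z' @ [z']) = {}"
        using path_system_into[OF P(2)] P(1) xS S(1) by (metis finite_insert)
      obtain w where w: "\<And>z. z \<in> ?Y \<Longrightarrow> path_between F {z} B (z # w z) \<and> set (w z) \<inter> ?Y = {}"
        "\<And>z z'. z \<in> ?Y \<Longrightarrow> z' \<in> ?Y \<Longrightarrow> z \<noteq> z' \<Longrightarrow> set (z # w z) \<inter> set (z' # w z') = {}"
        using path_system_from[OF Q(2)] Q(1) yS S(1) by (metis finite_insert)
      \<comment> \<open>If a walk into \<open>?X\<close> met a walk out of \<open>?Y\<close> outside
        \<open>S\<close>, switching at that vertex would give a walk in \<open>F\<close> from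
        \<open>A\<close> to \<open>B\<close> that avoids \<open>S\<close>.\<close>
      have meet: "v = z \<and> v = z' \<and> v \<in> S"
        if z: "z \<in> ?X" "z' \<in> ?Y" and v: "v \<in> set (u z @ [z])" "v \<in> set (z' # w z')" for z z' v
      proof -
        have "v \<in> S"
        proof (rule ccontr)
          assume "v \<notin> S"
          obtain p1 p2 where p: "u z @ [z] = p1 @ v # p2" using v(1) by (meson split_list)
          obtain q1 q2 where q: "z' # w z' = q1 @ v # q2" using v(2) by (meson split_list)
          have "path_between F A {v} (p1 @ [v])"
            using u(1)[OF z(1)] path_between_prefix unfolding p by metis
          moreover have "path_between F {v} B (v # q2)"
            using w(1)[OF z(2)] unfolding q
            by (auto simp: path_between_def successively_append_iff)
          ultimately have "path_between F A B (p1 @ v # q2)" by (rule path_between_join)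
          moreover have "set p1 \<subseteq> set (u z)"
            using arg_cong[OF p, of butlast] by (auto simp: butlast_append)
          moreover have "set q2 \<subseteq> set (w z')"
            using arg_cong[OF q, of tl] by (cases q1) auto
          ultimately show False
            using S(2) \<open>v \<notin> S\<close> u(1)[OF z(1)] w(1)[OF z(2)] by (fastforce simp: separates_def)
        qed
        then show ?thesis using v u(1)[OF z(1)] w(1)[OF z(2)] by auto
      qed
      \<comment> \<open>A walk ending in \<open>S\<close> continues from the same vertex; the one
        ending in \<open>x\<close> continues through the deleted arc from \<open>y\<close>.\<close>
      define j where "j z = (if z = x then y else z)" for z
      define R where "R z = (u z @ [z]) @ (if z = x then [y] else []) @ w (j z)" for z
      have jY: "j z \<in> ?Y" if "z \<in> ?X" for z using that by (auto simp: j_def)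
      have R: "path_between ?E A B (R z)" if z: "z \<in> ?X" for z
      proof (cases "z = x")
        case True
        have "path_between ?E A {z} (u z @ [z])" "path_between ?E {j z} B (j z # w (j z))"
          using u(1)[OF z] w(1)[OF jY[OF z]] by (auto intro: path_between_mono)
        then show ?thesis
          using True by (auto simp: R_def j_def path_between_def successively_append_iff hd_append)
      next
        case False
        then have "path_between F A B (u z @ z # w z)"
          using u(1)[OF z] w(1)[OF jY[OF z]] by (auto simp: j_def intro: path_between_join)
        then show ?thesis using False by (auto simp: R_def j_def intro: path_between_mono)
      qed
      have setR: "set (R z) \<subseteq> set (u z @ [z]) \<union> set (j z # w (j z))" for z
        by (auto simp: R_def j_def)
      have disj: "set (R z) \<inter> set (R z') = {}" if z: "z \<in> ?X" "z' \<in> ?X" "z \<noteq> z'" for z z'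
      proof -
        have "j z \<noteq> j z'" using z yS(1) by (auto simp: j_def split: if_splits)
        then have 1: "set (j z # w (j z)) \<inter> set (j z' # w (j z')) = {}"
          using w(2) jY z by blast
        have 2: "set (u a @ [a]) \<inter> set (j b # w (j b)) = {}"
          if "a \<in> ?X" "b \<in> ?X" "a \<noteq> b" for a b
        proof (rule ccontr)
          assume "set (u a @ [a]) \<inter> set (j b # w (j b)) \<noteq> {}"
          then obtain v where "v \<in> set (u a @ [a])" "v \<in> set (j b # w (j b))" by blast
          then have "v = a \<and> v = j b \<and> v \<in> S" by (rule meet[OF that(1) jY[OF that(2)]])
          then have "j b \<in> S" "j b = a" by metis+
          then show False using yS(1) that(3) unfolding j_def by (cases "b = x") simp_all
        qed
        have "set (u z @ [z]) \<inter> set (u z' @ [z']) = {}" by (rule u(2)[OF z])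
        moreover have "set (u z @ [z]) \<inter> set (j z' # w (j z')) = {}" by (rule 2[OF z])
        moreover have "set (j z # w (j z)) \<inter> set (u z' @ [z']) = {}"
          by (subst Int_commute, rule 2) (use z in auto)
        ultimately have "(set (u z @ [z]) \<union> set (j z # w (j z))) \<inter>
            (set (u z' @ [z']) \<union> set (j z' # w (j z'))) = {}"
          using 1 by (simp only: Int_Un_distrib Int_Un_distrib2 Un_empty_left)
        then show ?thesis using Int_mono[OF setR[of z] setR[of z']] by (simp only: subset_empty)
      qed
      have "inj_on R ?X"
      proof (rule inj_onI, rule ccontr)
        fix z z' assume z: "z \<in> ?X" "z' \<in> ?X" "R z = R z'" "z \<noteq> z'"
        have "z \<in> set (R z)" by (simp add: R_def)
        then show False using disj[OF z(1,2,4)] unfolding z(3) by simp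
      qed
      then have "card (R ` ?X) = k" using xS(2) by (simp only: card_image)
      moreover have "path_system ?E A B (R ` ?X)"
        unfolding path_system_def pairwise_def
      proof (intro conjI ballI impI)
        fix p assume "p \<in> R ` ?X"
        then obtain z where z: "p = R z" "z \<in> ?X" by (rule imageE)
        show "path_between ?E A B p" unfolding z(1) by (rule R) (rule z(2))
        fix q assume q: "q \<in> R ` ?X" "p \<noteq> q"
        from q(1) obtain z' where z': "q = R z'" "z' \<in> ?X" by (rule imageE)
        have "z \<noteq> z'" using q(2) z(1) z'(1) by metis
        then show "set p \<inter> set q = {}" unfolding z(1) z'(1) by (rule disj[OF z(2) z'(2)])
      qed
      moreover have "finite (R ` ?X)" using S(1) by simp
      ultimately show ?thesis unfolding e by (intro exI[of _ "R ` ?X"] conjI)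
    qed
  qed
qed

section \<open>Time-bounded execution\<close>

definition upd :: "string \<Rightarrow> nat \<Rightarrow> nat \<Rightarrow> memory \<Rightarrow> memory" where
  "upd A i n \<sigma> = \<sigma>(A := (\<sigma> A)(i := n))"

lemma upd_apply [simp]: "upd A i n \<sigma> B = (if B = A then (\<sigma> A)(i := n) else \<sigma> B)"
  by (simp add: upd_def)

text \<open>Total correctness with a time bound, stated for one start memory so that the
  postcondition can refer to it directly.\<close>

definition runs :: "program \<Rightarrow> memory \<Rightarrow> nat \<Rightarrow> (memory \<Rightarrow> bool) \<Rightarrow> bool" where
  "runs c \<sigma> T Q \<longleftrightarrow> (\<exists>t \<tau>. exec c \<sigma> t \<tau> \<and> t \<le> T \<and> Q \<tau>)"

lemma runs_weaken:
  assumes "runs c \<sigma> T Q" "T \<le> T'" "\<And>\<tau>. Q \<tau> \<Longrightarrow> Q' \<tau>"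
  shows "runs c \<sigma> T' Q'"
  using assms unfolding runs_def by (meson le_trans)

lemma runs_Skip_le: "Q \<sigma> \<Longrightarrow> 1 \<le> T \<Longrightarrow> runs Skip \<sigma> T Q"
  unfolding runs_def using exec.Skip by blast

lemma runs_Assign:
  assumes "Q (upd A (eval_expr i \<sigma>) (eval_expr e \<sigma>) \<sigma>)"
  shows "runs (Assign A i e) \<sigma> (expr_cost i + expr_cost e + 1) Q"
  unfolding runs_def using assms exec.Assign unfolding upd_def by blast

lemma runs_Seq:
  assumes "runs c \<sigma> T R" "\<And>\<tau>. R \<tau> \<Longrightarrow> runs d \<tau> T' Q"
  shows "runs (Seq c d) \<sigma> (T + T') Q"
  using assms unfolding runs_def by (meson add_mono exec.Seq)

lemma runs_Cond:
  assumes "eval_expr b \<sigma> \<noteq> 0 \<Longrightarrow> runs c \<sigma> T Q" "eval_expr b \<sigma> = 0 \<Longrightarrow> runs d \<sigma> T Q"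
  shows "runs (Cond b c d) \<sigma> (expr_cost b + 1 + T) Q"
  using assms unfolding runs_def by (meson add_left_mono exec.CondFalse exec.CondTrue)

section \<open>Frames and loop-free code\<close>

primrec writes :: "program \<Rightarrow> string set" where
  "writes Skip = {}"
| "writes (Assign A i e) = {A}"
| "writes (Seq c d) = writes c \<union> writes d"
| "writes (Cond b c d) = writes c \<union> writes d"
| "writes (While b c) = writes c"

lemma exec_frame: "exec c \<sigma> t \<tau> \<Longrightarrow> A \<notin> writes c \<Longrightarrow> \<tau> A = \<sigma> A"
  by (induction rule: exec.induct) auto

text \<open>Lets every specification and loop invariant speak only about the arrays that actually
  change.\<close>

lemma runs_frame:
  assumes "runs c \<sigma> T Q"
  shows "runs c \<sigma> T (\<lambda>\<tau>. Q \<tau> \<and> (\<forall>A. A \<notin> writes c \<longrightarrow> \<tau> A = \<sigma> A))"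
  using assms exec_frame unfolding runs_def by blast

text \<open>Symbolic execution of loop-free code, so that its specifications reduce to
  simplification; the value at \<open>While\<close> is a dummy.\<close>

primrec straight :: "program \<Rightarrow> memory \<Rightarrow> memory" where
  "straight Skip \<sigma> = \<sigma>"
| "straight (Assign A i e) \<sigma> = upd A (eval_expr i \<sigma>) (eval_expr e \<sigma>) \<sigma>"
| "straight (Seq c d) \<sigma> = straight d (straight c \<sigma>)"
| "straight (Cond b c d) \<sigma> = (if eval_expr b \<sigma> \<noteq> 0 then straight c \<sigma> else straight d \<sigma>)"
| "straight (While b c) \<sigma> = \<sigma>"

primrec while_free :: "program \<Rightarrow> bool" where
  "while_free Skip = True"
| "while_free (Assign A i e) = True"
| "while_free (Seq c d) = (while_free c \<and> while_free d)"
| "while_free (Cond b c d) = (while_free c \<and> while_free d)"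
| "while_free (While b c) = False"

text \<open>\<open>Cond\<close> is charged with its slower branch, which gives a bound independent
  of the memory.\<close>

primrec straight_time :: "program \<Rightarrow> nat" where
  "straight_time Skip = 1"
| "straight_time (Assign A i e) = expr_cost i + expr_cost e + 1"
| "straight_time (Seq c d) = straight_time c + straight_time d"
| "straight_time (Cond b c d) = expr_cost b + 1 + max (straight_time c) (straight_time d)"
| "straight_time (While b c) = 0"

lemma runs_straight:
  assumes "while_free c" "Q (straight c \<sigma>)"
  shows "runs c \<sigma> (straight_time c) Q"
  using assms
proof (induction c arbitrary: \<sigma> Q)
  case Skip
  then show ?case using runs_Skip_le[of Q \<sigma>] by simp
next
  case (Assign A i e)
  then show ?case unfolding straight.simps straight_time.simps by (intro runs_Assign)
next
  case (Seq c d)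
  have "runs c \<sigma> (straight_time c) (\<lambda>\<tau>. \<tau> = straight c \<sigma>)" using Seq by simp
  then show ?case unfolding straight_time.simps by (rule runs_Seq) (use Seq in simp)
next
  case (Cond b c d)
  have "runs c \<sigma> (max (straight_time c) (straight_time d)) Q" if "eval_expr b \<sigma> \<noteq> 0"
    by (rule runs_weaken[OF Cond.IH(1)[of Q \<sigma>]]) (use Cond.prems that in auto)
  moreover have "runs d \<sigma> (max (straight_time c) (straight_time d)) Q" if "eval_expr b \<sigma> = 0"
    by (rule runs_weaken[OF Cond.IH(2)[of Q \<sigma>]]) (use Cond.prems that in auto)
  ultimately show ?case unfolding straight_time.simps by (rule runs_Cond)
qed simp

section \<open>Counting loops\<close>

abbreviation var :: "string \<Rightarrow> expr" where
  "var x \<equiv> Cell x (Num 0)"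

text \<open>Every loop of the algorithm runs \<open>m\<close> times, so the bound is fixed. By
  truncation, \<open>m - x\<close> is nonzero exactly while \<open>x < m\<close>.\<close>

definition For :: "string \<Rightarrow> program \<Rightarrow> program" where
  "For x c = Seq (Assign x (Num 0) (Num 0))
     (While (Sub (var ''m'') (var x)) (Seq c (Assign x (Num 0) (Add (var x) (Num 1)))))"

text \<open>Each round adds 6 units for the test and 6 for the increment; the 9 are 3 for the
  initialisation and 6 for the last, failing test.\<close>

definition for_time :: "nat \<Rightarrow> nat \<Rightarrow> nat" where
  "for_time m T = m * (T + 12) + 9"

lemma writes_For [simp]: "writes (For x c) = insert x (writes c)"
  by (auto simp: For_def)

text \<open>The invariant is stated for the memory after the counter has been set. The step may also
  use that all arrays outside \<open>writes c\<close>, except the counter, still have their values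
  from before the loop.\<close>

lemma runs_For:
  assumes m: "\<sigma> ''m'' 0 = m" and x: "x \<noteq> ''m''" "x \<notin> writes c" "''m'' \<notin> writes c"
    and init: "I 0 (upd x 0 0 \<sigma>)"
    and step: "\<And>i \<rho>. i < m \<Longrightarrow> I i \<rho> \<Longrightarrow> \<rho> x 0 = i \<Longrightarrow>
      (\<And>A. A \<noteq> x \<Longrightarrow> A \<notin> writes c \<Longrightarrow> \<rho> A = \<sigma> A) \<Longrightarrow>
      runs c \<rho> T (\<lambda>\<tau>. I (Suc i) (upd x 0 (Suc i) \<tau>))"
  shows "runs (For x c) \<sigma> (for_time m T) (I m)"
proof -
  let ?b = "Sub (var ''m'') (var x)"
  let ?w = "While ?b (Seq c (Assign x (Num 0) (Add (var x) (Num 1))))"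
  have loop: "runs ?w \<rho> (k * (T + 12) + 6) (I m)"
    if "k = m - i" "i \<le> m" "I i \<rho>" "\<rho> x 0 = i" "\<And>A. A \<noteq> x \<Longrightarrow> A \<notin> writes c \<Longrightarrow> \<rho> A = \<sigma> A"
    for k i \<rho>
    using that
  proof (induction k arbitrary: i \<rho>)
    case 0
    then have "i = m" "eval_expr ?b \<rho> = 0" using m x by auto
    then have "exec ?w \<rho> 6 \<rho>" using exec.WhileFalse[of ?b \<rho>] by (simp add: numeral_eq_Suc)
    then show ?case using 0 \<open>i = m\<close> unfolding runs_def by auto
  next
    case (Suc k)
    have nz: "eval_expr ?b \<rho> \<noteq> 0" using Suc.prems m x by auto
    have "i < m" using Suc.prems by auto
    from runs_frame[OF step[OF this Suc.prems(3,4,5)]] obtain t \<tau> where \<tau>: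
      "exec c \<rho> t \<tau>" "t \<le> T" "I (Suc i) (upd x 0 (Suc i) \<tau>)"
      "\<And>A. A \<notin> writes c \<Longrightarrow> \<tau> A = \<rho> A"
      unfolding runs_def by blast
    let ?\<tau> = "upd x 0 (Suc i) \<tau>"
    have "\<tau> x 0 = i" using \<tau>(4) x Suc.prems by simp
    then have inc: "exec (Assign x (Num 0) (Add (var x) (Num 1))) \<tau> 6 ?\<tau>"
      using exec.Assign[of x "Num 0" "Add (var x) (Num 1)" \<tau>] by (simp add: numeral_eq_Suc upd_def)
    have "runs ?w ?\<tau> (k * (T + 12) + 6) (I m)"
    proof (rule Suc.IH)
      show "k = m - Suc i" "Suc i \<le> m" using Suc.prems(1) \<open>i < m\<close> by linarith+
      show "I (Suc i) ?\<tau>" by (rule \<tau>(3))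
      show "?\<tau> x 0 = Suc i" by simp
      show "?\<tau> A = \<sigma> A" if "A \<noteq> x" "A \<notin> writes c" for A
        using that \<tau>(4) Suc.prems(5) by simp
    qed
    then obtain t' \<rho>' where fin: "exec ?w ?\<tau> t' \<rho>'" "t' \<le> k * (T + 12) + 6" "I m \<rho>'"
      unfolding runs_def by blast
    have "exec ?w \<rho> (expr_cost ?b + 1 + (t + 6) + t') \<rho>'"
      using nz exec.Seq[OF \<tau>(1) inc] fin(1) by (rule exec.WhileTrue)
    moreover have "expr_cost ?b + 1 + (t + 6) + t' \<le> Suc k * (T + 12) + 6"
      using \<tau>(2) fin(2) by simp
    ultimately show ?case using fin(3) unfolding runs_def by blast
  qed
  let ?\<rho> = "upd x 0 0 \<sigma>"
  have "exec (Assign x (Num 0) (Num 0)) \<sigma> 3 ?\<rho>"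
    using exec.Assign[of x "Num 0" "Num 0" \<sigma>] by (simp add: numeral_eq_Suc upd_def)
  then have "runs (Assign x (Num 0) (Num 0)) \<sigma> 3 (\<lambda>\<tau>. \<tau> = ?\<rho>)" unfolding runs_def by blast
  then have "runs (For x c) \<sigma> (3 + (m * (T + 12) + 6)) (I m)"
    unfolding For_def by (rule runs_Seq) (use loop[of m 0 ?\<rho>] init in simp)
  then show ?thesis by (simp add: for_time_def add.commute)
qed

section \<open>Polynomial time bounds\<close>

definition polynomially_bounded :: "(nat \<Rightarrow> nat) \<Rightarrow> bool" where
  "polynomially_bounded T \<longleftrightarrow> (\<exists>q :: nat poly. \<forall>n. T n \<le> poly q n)"

lemma polynomially_bounded_const: "polynomially_bounded (\<lambda>_. c)"
  unfolding polynomially_bounded_def by (rule exI[of _ "[:c:]"]) simp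

lemma polynomially_bounded_id: "polynomially_bounded (\<lambda>n. n)"
  unfolding polynomially_bounded_def by (rule exI[of _ "[:0, 1:]"]) simp

lemma polynomially_bounded_add:
  "polynomially_bounded S \<Longrightarrow> polynomially_bounded T \<Longrightarrow> polynomially_bounded (\<lambda>n. S n + T n)"
  unfolding polynomially_bounded_def by (metis add_mono poly_add)

lemma polynomially_bounded_mult:
  "polynomially_bounded S \<Longrightarrow> polynomially_bounded T \<Longrightarrow> polynomially_bounded (\<lambda>n. S n * T n)"
  unfolding polynomially_bounded_def by (metis mult_le_mono poly_mult)

lemma polynomially_bounded_for_time:
  "polynomially_bounded T \<Longrightarrow> polynomially_bounded (\<lambda>n. for_time n (T n))"
  unfolding for_time_def
  by (intro polynomially_bounded_add polynomially_bounded_mult polynomially_bounded_id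
      polynomially_bounded_const)

lemmas polynomially_bounded_intros =
  polynomially_bounded_const polynomially_bounded_id polynomially_bounded_add
  polynomially_bounded_mult polynomially_bounded_for_time

text \<open>Turns a bound in the number of arcs into one in the input size.\<close>

lemma poly_nat_mono: "m \<le> n \<Longrightarrow> poly q m \<le> poly q n" for q :: "nat poly"
  by (induction q) (auto intro: add_mono mult_le_mono)

section \<open>The program\<close>

abbreviation item :: "string \<Rightarrow> string \<Rightarrow> expr" where
  "item A x \<equiv> Cell A (var x)"

text \<open>Arc \<open>j\<close> has tail \<open>u[j]\<close>, head \<open>v[j]\<close>, capacity \<open>c[j]\<close> and key \<open>k[j]\<close>, and it is alive if
  \<open>a[j] \<noteq> 0\<close>. The array \<open>b\<close>, indexed by keys, counts how often a key is removed at present, as nested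
  loops may remove the same key repeatedly; \<open>r\<close>, indexed by vertices, marks the reached ones. The flag
  \<open>f\<close> reports a cut, and \<open>w\<close> is the value of the best flow written to \<open>out\<close> so far.\<close>

definition clear_ends :: program where
  "clear_ends = Seq (Assign ''r'' (item ''u'' ''j'') (Num 0)) (Assign ''r'' (item ''v'' ''j'') (Num 0))"

definition mark_source :: program where
  "mark_source = Seq (Assign ''r'' (var ''t'') (Num 0)) (Assign ''r'' (var ''s'') (Num 1))"

definition relax :: program where
  "relax = Cond (Cell ''b'' (item ''k'' ''j'')) Skip
     (Cond (item ''a'' ''j'')
       (Cond (Cell ''r'' (item ''u'' ''j'')) (Assign ''r'' (item ''v'' ''j'') (Num 1)) Skip) Skip)"

text \<open>Vertices are arbitrary numbers, so only the cells of arc ends, source and sink are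
  initialised. Each round relaxes all arcs, and \<open>m\<close> rounds suffice because whatever is
  reachable is reachable in at most \<open>m\<close> steps.\<close>

definition reach :: program where
  "reach = Seq (For ''j'' clear_ends) (Seq mark_source (For ''i'' (For ''j'' relax)))"

text \<open>Names made of the letter x only: distinct for distinct \<open>k\<close>, and distinct
  from all other array names, none of which begins with x.\<close>

definition counter :: "nat \<Rightarrow> string" where
  "counter k = replicate (Suc k) CHR ''x''"

definition block :: "nat \<Rightarrow> program" where
  "block k = Assign ''b'' (item ''k'' (counter k)) (Add (Cell ''b'' (item ''k'' (counter k))) (Num 1))"

definition unblock :: "nat \<Rightarrow> program" where
  "unblock k = Assign ''b'' (item ''k'' (counter k)) (Sub (Cell ''b'' (item ''k'' (counter k))) (Num 1))"

definition flag_unreached :: program where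
  "flag_unreached = Cond (Cell ''r'' (var ''t'')) Skip (Assign ''f'' (Num 0) (Num 1))"

text \<open>The loops choose \<open>k\<close> arcs with repetition and thereby also try the smaller
  nonempty sets of keys. There are \<open>m ^ k\<close> choices, polynomially many for each fixed
  \<open>k\<close>.\<close>

primrec cut_search :: "nat \<Rightarrow> program" where
  "cut_search 0 = Seq reach flag_unreached"
| "cut_search (Suc k) = For (counter k) (Seq (block k) (Seq (cut_search k) (unblock k)))"

definition check_robust :: "nat \<Rightarrow> program" where
  "check_robust k = Seq (Assign ''f'' (Num 0) (Num 0)) (cut_search k)"

definition drop_arc :: program where
  "drop_arc = Assign ''a'' (var ''d'') (Num 0)"

definition undrop_arc :: program where
  "undrop_arc = Cond (var ''f'') (Assign ''a'' (var ''d'') (Num 1)) Skip"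

definition prune :: "nat \<Rightarrow> program" where
  "prune k = For ''d'' (Seq drop_arc (Seq (check_robust k) undrop_arc))"

text \<open>The machine has no multiplication, but a constant factor unfolds into additions.\<close>

primrec times :: "nat \<Rightarrow> expr \<Rightarrow> expr" where
  "times 0 e = Num 0"
| "times (Suc n) e = Add (times n e) e"

text \<open>With truncated subtraction, \<open>1 - (c[e] - c[l])\<close> is 1 if
  \<open>c[e] \<le> c[l]\<close> and 0 otherwise.\<close>

definition select_wide :: program where
  "select_wide = Assign ''a'' (var ''l'')
     (Sub (Num 1) (Sub (item ''c'' ''e'') (item ''c'' ''l'')))"

definition write_flow :: program where
  "write_flow = Cond (item ''a'' ''l'') (Assign ''out'' (var ''l'') (item ''c'' ''e''))
     (Assign ''out'' (var ''l'') (Num 0))"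

definition set_best :: "nat \<Rightarrow> program" where
  "set_best k = Assign ''w'' (Num 0) (times (Suc k) (item ''c'' ''e''))"

definition record_flow :: "nat \<Rightarrow> program" where
  "record_flow k = Seq (prune k) (Seq (For ''l'' write_flow) (set_best k))"

text \<open>Tries \<open>Suc k\<close> paths with common amount \<open>c[e]\<close>. The truncated
  difference is nonzero exactly if this would beat the best value so far, so a flow is overwritten
  only by a better one.\<close>

definition improve :: "nat \<Rightarrow> program" where
  "improve k = Cond (Sub (times (Suc k) (item ''c'' ''e'')) (var ''w''))
     (Seq (For ''l'' select_wide) (Seq (check_robust k) (Cond (var ''f'') Skip (record_flow k)))) Skip"

primrec optimize :: "nat \<Rightarrow> program" where
  "optimize 0 = Skip"
| "optimize (Suc k) = Seq (optimize k) (For ''e'' (improve k))"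

text \<open>\<open>p\<close> points to the first arc triple, behind the four header numbers and the
  vertex list.\<close>

definition load_header :: program where
  "load_header =
     Seq (Assign ''m'' (Num 0) (Cell ''in'' (Num 1)))
     (Seq (Assign ''s'' (Num 0) (Cell ''in'' (Num 2)))
     (Seq (Assign ''t'' (Num 0) (Cell ''in'' (Num 3)))
     (Seq (Assign ''outlen'' (Num 0) (Cell ''in'' (Num 1)))
       (Assign ''p'' (Num 0) (Add (Cell ''in'' (Num 0)) (Num 4))))))"

definition load_arc :: program where
  "load_arc =
     Seq (Assign ''u'' (var ''l'') (item ''in'' ''p''))
     (Seq (Assign ''v'' (var ''l'') (Cell ''in'' (Add (var ''p'') (Num 1))))
     (Seq (Assign ''c'' (var ''l'') (Cell ''in'' (Add (var ''p'') (Num 2))))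
       (Assign ''p'' (Num 0) (Add (var ''p'') (Num 3)))))"

definition solve :: "program \<Rightarrow> nat \<Rightarrow> program" where
  "solve set_key p = Seq load_header (Seq (For ''l'' (Seq load_arc set_key)) (optimize p))"

definition key_by_arc :: program where
  "key_by_arc = Assign ''k'' (var ''l'') (var ''l'')"

text \<open>The sum of both truncated differences is zero exactly if the head is the sink. Adding
  \<open>m\<close> keeps the keys made from heads apart from the arc numbers used at the
  sink.\<close>

definition key_by_head :: program where
  "key_by_head =
     Cond (Add (Sub (item ''v'' ''l'') (var ''t'')) (Sub (var ''t'') (item ''v'' ''l'')))
       (Assign ''k'' (var ''l'') (Add (var ''m'') (item ''v'' ''l'')))
       (Assign ''k'' (var ''l'') (var ''l''))"

lemma eval_times [simp]: "eval_expr (times n e) \<sigma> = n * eval_expr e \<sigma>"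
  by (induction n) auto

lemma while_free_simps [simp]:
  "while_free clear_ends" "while_free mark_source" "while_free relax" "while_free (block k)"
  "while_free (unblock k)" "while_free flag_unreached" "while_free drop_arc"
  "while_free undrop_arc" "while_free select_wide" "while_free write_flow"
  "while_free (set_best k)" "while_free load_header" "while_free load_arc"
  "while_free key_by_arc" "while_free key_by_head"
  by (simp_all add: clear_ends_def mark_source_def relax_def block_def unblock_def
      flag_unreached_def drop_arc_def undrop_arc_def select_wide_def write_flow_def set_best_def
      load_header_def load_arc_def key_by_arc_def key_by_head_def)

section \<open>Running times of the subprograms\<close>

definition reach_time :: "nat \<Rightarrow> nat" where
  "reach_time m = for_time m (straight_time clear_ends) +
     (straight_time mark_source + for_time m (for_time m (straight_time relax)))"

primrec cut_search_time :: "nat \<Rightarrow> nat \<Rightarrow> nat" where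
  "cut_search_time 0 m = reach_time m + straight_time flag_unreached"
| "cut_search_time (Suc k) m =
     for_time m (straight_time (block k) + (cut_search_time k m + straight_time (unblock k)))"

definition check_robust_time :: "nat \<Rightarrow> nat \<Rightarrow> nat" where
  "check_robust_time k m = 3 + cut_search_time k m"

definition prune_time :: "nat \<Rightarrow> nat \<Rightarrow> nat" where
  "prune_time k m =
     for_time m (straight_time drop_arc + (check_robust_time k m + straight_time undrop_arc))"

definition record_flow_time :: "nat \<Rightarrow> nat \<Rightarrow> nat" where
  "record_flow_time k m =
     prune_time k m + (for_time m (straight_time write_flow) + straight_time (set_best k))"

definition improve_time :: "nat \<Rightarrow> nat \<Rightarrow> nat" where
  "improve_time k m =
     expr_cost (Sub (times (Suc k) (item ''c'' ''e'')) (var ''w'')) + 1 +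
     (for_time m (straight_time select_wide) + (check_robust_time k m + (3 + record_flow_time k m)))"

primrec optimize_time :: "nat \<Rightarrow> nat \<Rightarrow> nat" where
  "optimize_time 0 m = 1"
| "optimize_time (Suc k) m = optimize_time k m + for_time m (improve_time k m)"

definition solve_time :: "program \<Rightarrow> nat \<Rightarrow> nat \<Rightarrow> nat" where
  "solve_time set_key p m = straight_time load_header +
     (for_time m (straight_time (Seq load_arc set_key)) + optimize_time p m)"

lemma polynomially_bounded_cut_search_time: "polynomially_bounded (cut_search_time k)"
proof (induction k)
  case 0
  show ?case unfolding cut_search_time.simps reach_time_def by (intro polynomially_bounded_intros)
next
  case (Suc k)
  then show ?case unfolding cut_search_time.simps by (intro polynomially_bounded_intros)
qed

lemma polynomially_bounded_improve_time: "polynomially_bounded (improve_time k)"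
  unfolding improve_time_def record_flow_time_def prune_time_def check_robust_time_def
  by (intro polynomially_bounded_intros polynomially_bounded_cut_search_time)

lemma polynomially_bounded_optimize_time: "polynomially_bounded (optimize_time p)"
proof (induction p)
  case 0
  show ?case unfolding optimize_time.simps by (rule polynomially_bounded_const)
next
  case (Suc p)
  then show ?case unfolding optimize_time.simps
    by (intro polynomially_bounded_intros polynomially_bounded_improve_time)
qed

lemma polynomially_bounded_solve_time: "polynomially_bounded (solve_time set_key p)"
  unfolding solve_time_def
  by (intro polynomially_bounded_intros polynomially_bounded_optimize_time)

section \<open>Arrays changed by the subprograms\<close>

lemma writes_reach [simp]: "writes reach = {''r'', ''i'', ''j''}"
  by (auto simp: reach_def clear_ends_def mark_source_def relax_def)

lemma writes_cut_search:
  "writes (cut_search k) \<subseteq> {''r'', ''i'', ''j'', ''f'', ''b''} \<union> counter ` {..<k}"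
  by (induction k) (auto simp: flag_unreached_def block_def unblock_def)

lemma counter_neq [simp]:
  "A \<noteq> [] \<Longrightarrow> hd A \<noteq> CHR ''x'' \<Longrightarrow> counter k \<noteq> A"
  "A \<noteq> [] \<Longrightarrow> hd A \<noteq> CHR ''x'' \<Longrightarrow> A \<noteq> counter k"
  by (auto simp: counter_def)

lemma counter_inj [simp]: "counter k = counter l \<longleftrightarrow> k = l"
  by (auto simp: counter_def)

lemma not_writes_cut_search:
  assumes "A \<noteq> []" "hd A \<noteq> CHR ''x''" "A \<notin> {''r'', ''i'', ''j'', ''f'', ''b''}"
  shows "A \<notin> writes (cut_search k)"
  using writes_cut_search[of k] assms by (auto simp: counter_def Cons_replicate_eq)

lemma counter_not_writes_cut_search: "counter k \<notin> writes (cut_search k)"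
  using writes_cut_search[of k] by auto

section \<open>Correctness of the program\<close>

text \<open>The behaviour of the program is described for an arbitrary \<open>key\<close>; that keys
  determine heads and express disjointness enters only later, in
  \<open>keyed_network\<close>.\<close>

locale arc_table =
  fixes as :: "(nat \<times> nat) list" and key :: "nat \<times> nat \<Rightarrow> nat" and cap :: "nat \<times> nat \<Rightarrow> nat"
    and s t :: nat
  assumes s_neq_t: "s \<noteq> t" and distinct_arcs: "distinct as"
begin

abbreviation m :: nat where
  "m \<equiv> length as"

text \<open>The arrays that are only read once the input has been loaded.\<close>

definition tables :: "string set" where
  "tables = {''m'', ''s'', ''t'', ''u'', ''v'', ''c'', ''k''}"

definition stored :: "memory \<Rightarrow> bool" where
  "stored \<sigma> \<longleftrightarrow> \<sigma> ''m'' 0 = m \<and> \<sigma> ''s'' 0 = s \<and> \<sigma> ''t'' 0 = t \<and>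
     (\<forall>j<m. \<sigma> ''u'' j = fst (as ! j) \<and> \<sigma> ''v'' j = snd (as ! j) \<and>
        \<sigma> ''c'' j = cap (as ! j) \<and> \<sigma> ''k'' j = key (as ! j))"

lemma stored_frame:
  assumes "stored \<sigma>" "\<And>A. A \<in> tables \<Longrightarrow> \<tau> A = \<sigma> A"
  shows "stored \<tau>"
  using assms by (simp add: stored_def tables_def)

definition live :: "memory \<Rightarrow> (nat \<times> nat) set" where
  "live \<sigma> = {as ! j | j. j < m \<and> \<sigma> ''a'' j \<noteq> 0}"

definition blocked :: "memory \<Rightarrow> nat set" where
  "blocked \<sigma> = {\<kappa>. \<sigma> ''b'' \<kappa> \<noteq> 0}"

definition linked :: "(nat \<times> nat) set \<Rightarrow> nat set \<Rightarrow> bool" where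
  "linked S K \<longleftrightarrow> (s, t) \<in> {a \<in> S. key a \<notin> K}\<^sup>*"

text \<open>Mirrors the nested loops of \<open>cut_search\<close>, so that their correctness is a
  direct induction. The link with sets of at most \<open>k\<close> keys is made by
  \<open>robust_linked\<close> and \<open>linked_robust\<close>.\<close>

primrec robust :: "nat \<Rightarrow> (nat \<times> nat) set \<Rightarrow> nat set \<Rightarrow> bool" where
  "robust 0 S K = linked S K"
| "robust (Suc k) S K = (\<forall>a \<in> set as. robust k S (insert (key a) K))"

lemma linked_mono: "linked S K \<Longrightarrow> S \<subseteq> S' \<Longrightarrow> linked S' K"
  unfolding linked_def by (rule rtrancl_mono[THEN subsetD]) auto

lemma robust_mono: "robust k S K \<Longrightarrow> S \<subseteq> S' \<Longrightarrow> robust k S' K"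
  by (induction k arbitrary: K) (auto intro: linked_mono)

lemma live_subset: "live \<sigma> \<subseteq> set as"
  by (auto simp: live_def)

lemma nth_in_live: "j < m \<Longrightarrow> as ! j \<in> live \<sigma> \<longleftrightarrow> \<sigma> ''a'' j \<noteq> 0"
  using distinct_arcs by (auto simp: live_def nth_eq_iff_index_eq)

lemma runs_reach:
  assumes st: "stored \<sigma>"
  shows "runs reach \<sigma> (reach_time m) (\<lambda>\<tau>. \<tau> ''r'' t \<noteq> 0 \<longleftrightarrow> linked (live \<sigma>) (blocked \<sigma>))"
proof -
  define R where "R = {a \<in> live \<sigma>. key a \<notin> blocked \<sigma>}"
  \<comment> \<open>The initialised cells of \<open>r\<close>; the claim that a marked vertex is
    reachable is confined to them.\<close>
  define V where "V = insert s (insert t (fst ` set as \<union> snd ` set as))"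
  have R_nth: "as ! j \<in> R \<longleftrightarrow> \<sigma> ''a'' j \<noteq> 0 \<and> \<sigma> ''b'' (key (as ! j)) = 0" if "j < m" for j
    using that by (auto simp: R_def nth_in_live blocked_def)
  have R_as: "R \<subseteq> set as" using live_subset by (auto simp: R_def)
  define zero where "zero j \<tau> \<longleftrightarrow>
    (\<forall>j'<j. \<tau> ''r'' (fst (as ! j')) = 0 \<and> \<tau> ''r'' (snd (as ! j')) = 0)" for j and \<tau> :: memory
  have 1: "runs (For ''j'' clear_ends) \<sigma> (for_time m (straight_time clear_ends)) (zero m)"
  proof (rule runs_For[where I = zero])
    show "\<sigma> ''m'' 0 = m" using st by (simp add: stored_def)
    fix j \<rho> assume j: "j < m" "zero j \<rho>" "\<rho> ''j'' 0 = j"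
      "\<And>A. A \<noteq> ''j'' \<Longrightarrow> A \<notin> writes clear_ends \<Longrightarrow> \<rho> A = \<sigma> A"
    have "stored \<rho>" using st j(4) by (rule stored_frame) (auto simp: tables_def clear_ends_def)
    then have vals: "\<rho> ''u'' j = fst (as ! j)" "\<rho> ''v'' j = snd (as ! j)"
      using j(1) by (auto simp: stored_def)
    define \<rho>' where "\<rho>' = straight clear_ends \<rho>"
    have "\<rho>' ''r'' = (\<rho> ''r'')(fst (as ! j) := 0, snd (as ! j) := 0)"
      using j(3) vals by (simp add: \<rho>'_def clear_ends_def)
    then have "zero (Suc j) (upd ''j'' 0 (Suc j) (straight clear_ends \<rho>))"
      using j(2) by (simp add: zero_def All_less_Suc \<rho>'_def)
    then show "runs clear_ends \<rho> (straight_time clear_ends)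
        (\<lambda>\<tau>. zero (Suc j) (upd ''j'' 0 (Suc j) \<tau>))"
      by (intro runs_straight while_free_simps)
  qed (auto simp: clear_ends_def zero_def)
  define init where "init \<tau> \<longleftrightarrow> (\<forall>v \<in> V. \<tau> ''r'' v \<noteq> 0 \<longleftrightarrow> v = s)" for \<tau> :: memory
  have 2: "runs mark_source \<tau> (straight_time mark_source) init" if "zero m \<tau>" "\<And>A. A \<noteq> ''j'' \<Longrightarrow> A \<noteq> ''r'' \<Longrightarrow> \<tau> A = \<sigma> A" for \<tau>
  proof -
    have "stored \<tau>" using st that(2) by (rule stored_frame) (auto simp: tables_def)
    then have "straight mark_source \<tau> ''r'' = (\<tau> ''r'')(t := 0, s := 1)"
      by (simp add: mark_source_def stored_def)
    moreover have "\<tau> ''r'' (fst a) = 0 \<and> \<tau> ''r'' (snd a) = 0" if "a \<in> set as" for a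
      using \<open>zero m \<tau>\<close> that by (metis zero_def in_set_conv_nth)
    ultimately have "init (straight mark_source \<tau>)"
      using s_neq_t by (auto simp: init_def V_def)
    then show ?thesis by (intro runs_straight while_free_simps)
  qed
  \<comment> \<open>Marks are sound and, up to distance \<open>i\<close>, complete. Soundness has no
    distance bound, as marks may travel along several arcs within one round.\<close>
  define near where "near i \<tau> \<longleftrightarrow> (\<forall>v \<in> V. \<tau> ''r'' v \<noteq> 0 \<longrightarrow> (s, v) \<in> R\<^sup>*) \<and>
    (\<forall>k\<le>i. \<forall>v. (s, v) \<in> R ^^ k \<longrightarrow> \<tau> ''r'' v \<noteq> 0)" for i and \<tau> :: memory
  have 3: "runs (For ''i'' (For ''j'' relax)) \<tau> (for_time m (for_time m (straight_time relax))) (near m)"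
    if \<tau>: "init \<tau>" "\<And>A. A \<noteq> ''j'' \<Longrightarrow> A \<noteq> ''r'' \<Longrightarrow> \<tau> A = \<sigma> A" for \<tau>
  proof (rule runs_For[where I = near])
    show "\<tau> ''m'' 0 = m" using st \<tau>(2) by (simp add: stored_def)
    show "near 0 (upd ''i'' 0 0 \<tau>)" using \<tau>(1) by (auto simp: near_def init_def V_def)
    fix i \<rho> assume i: "i < m" "near i \<rho>" "\<rho> ''i'' 0 = i"
      "\<And>A. A \<noteq> ''i'' \<Longrightarrow> A \<notin> writes (For ''j'' relax) \<Longrightarrow> \<rho> A = \<tau> A"
    \<comment> \<open>The invariant inside round \<open>i\<close>: arcs already relaxed have passed
      on the marks of tails at distance at most \<open>i\<close>. Once all arcs are relaxed, this is
      completeness up to distance \<open>Suc i\<close>.\<close>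
    define part where "part j \<tau> \<longleftrightarrow> near i \<tau> \<and> (\<forall>j'<j. \<forall>k\<le>i. as ! j' \<in> R \<longrightarrow>
       (s, fst (as ! j')) \<in> R ^^ k \<longrightarrow> \<tau> ''r'' (snd (as ! j')) \<noteq> 0)" for j and \<tau> :: memory
    have \<rho>: "\<rho> A = \<sigma> A" if "A \<notin> {''i'', ''j'', ''r''}" for A
      using that \<tau>(2) i(4) by (simp add: relax_def)
    have "runs (For ''j'' relax) \<rho> (for_time m (straight_time relax)) (part m)"
    proof (rule runs_For[where I = part])
      show "\<rho> ''m'' 0 = m" using st \<rho> by (simp add: stored_def)
      show "part 0 (upd ''j'' 0 0 \<rho>)" using i(2) by (simp add: part_def near_def)
      fix j \<mu> assume j: "j < m" "part j \<mu>" "\<mu> ''j'' 0 = j"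
        "\<And>A. A \<noteq> ''j'' \<Longrightarrow> A \<notin> writes relax \<Longrightarrow> \<mu> A = \<rho> A"
      have \<mu>: "\<mu> A = \<sigma> A" if "A \<notin> {''i'', ''j'', ''r''}" for A
        using that \<rho> j(4) by (simp add: relax_def)
      have st\<mu>: "stored \<mu>" using st \<mu> by (rule stored_frame) (auto simp: tables_def)
      have V: "fst (as ! j) \<in> V" "snd (as ! j) \<in> V" using j(1) by (auto simp: V_def)
      have step: "(s, snd (as ! j)) \<in> R\<^sup>*" if "(s, fst (as ! j)) \<in> R\<^sup>*" "as ! j \<in> R"
        using that by (metis prod.collapse rtrancl.rtrancl_into_rtrancl)
      have R: "as ! j \<in> R \<longleftrightarrow> \<mu> ''a'' j \<noteq> 0 \<and> \<mu> ''b'' (key (as ! j)) = 0"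
        using R_nth[OF j(1)] \<mu> by simp
      have vals: "\<mu> ''u'' j = fst (as ! j)" "\<mu> ''v'' j = snd (as ! j)" "\<mu> ''k'' j = key (as ! j)"
        using st\<mu> j(1) by (auto simp: stored_def)
      define \<mu>' where "\<mu>' = straight relax \<mu>"
      have r: "\<mu>' ''r'' = (if as ! j \<in> R \<and> \<mu> ''r'' (fst (as ! j)) \<noteq> 0
          then (\<mu> ''r'')(snd (as ! j) := 1) else \<mu> ''r'')"
        using j(3) vals R by (simp add: \<mu>'_def relax_def)
      have nr: "near i \<mu>" using j(2) by (simp add: part_def)
      have up: "\<mu> ''r'' v \<noteq> 0 \<Longrightarrow> \<mu>' ''r'' v \<noteq> 0" for v by (simp add: r)
      have "near i \<mu>'" unfolding near_def
      proof (intro conjI ballI impI allI)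
        fix v assume "v \<in> V" "\<mu>' ''r'' v \<noteq> 0"
        then show "(s, v) \<in> R\<^sup>*"
          using nr V step by (auto simp: r near_def split: if_splits)
      next
        fix k v assume "k \<le> i" "(s, v) \<in> R ^^ k"
        then show "\<mu>' ''r'' v \<noteq> 0" using nr up by (auto simp: near_def)
      qed
      moreover have "\<mu>' ''r'' (snd (as ! j')) \<noteq> 0"
        if "j' < Suc j" "k \<le> i" "as ! j' \<in> R" "(s, fst (as ! j')) \<in> R ^^ k" for j' k
      proof (cases "j' = j")
        case True
        then have "\<mu> ''r'' (fst (as ! j)) \<noteq> 0" using that nr by (auto simp: near_def)
        then show ?thesis using that(3) True by (simp add: r)
      next
        case False
        then have "\<mu> ''r'' (snd (as ! j')) \<noteq> 0" using that j(2) by (simp add: part_def)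
        then show ?thesis by (rule up)
      qed
      ultimately have "part (Suc j) (upd ''j'' 0 (Suc j) (straight relax \<mu>))"
        by (simp add: part_def near_def \<mu>'_def)
      then show "runs relax \<mu> (straight_time relax) (\<lambda>\<tau>. part (Suc j) (upd ''j'' 0 (Suc j) \<tau>))"
        by (intro runs_straight while_free_simps)
    qed (auto simp: relax_def)
    moreover have "near (Suc i) (upd ''i'' 0 (Suc i) \<tau>)" if "part m \<tau>" for \<tau>
      unfolding near_def
    proof (intro conjI ballI impI allI)
      fix v assume "v \<in> V" "upd ''i'' 0 (Suc i) \<tau> ''r'' v \<noteq> 0"
      then show "(s, v) \<in> R\<^sup>*" using that by (simp add: part_def near_def)
    next
      fix k v assume k: "k \<le> Suc i" "(s, v) \<in> R ^^ k"
      have "\<tau> ''r'' v \<noteq> 0"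
      proof (cases "k = Suc i")
        case True
        then obtain u where u: "(s, u) \<in> R ^^ i" "(u, v) \<in> R" using k(2) by auto
        then obtain j where j: "j < m" "as ! j = (u, v)" using R_as by (metis in_set_conv_nth subsetD)
        have "\<tau> ''r'' (snd (as ! j)) \<noteq> 0"
          using that[unfolded part_def] j u by fastforce
        then show ?thesis using j(2) by simp
      next
        case False
        then have "k \<le> i" using k(1) by simp
        then show ?thesis using k(2) that by (simp add: part_def near_def)
      qed
      then show "upd ''i'' 0 (Suc i) \<tau> ''r'' v \<noteq> 0" by simp
    qed
    ultimately show "runs (For ''j'' relax) \<rho> (for_time m (straight_time relax))
        (\<lambda>\<tau>. near (Suc i) (upd ''i'' 0 (Suc i) \<tau>))"
      by (simp add: runs_weaken[OF _ order_refl])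
  qed (auto simp: relax_def)
  have fin: "\<tau> ''r'' t \<noteq> 0 \<longleftrightarrow> linked (live \<sigma>) (blocked \<sigma>)" if "near m \<tau>" for \<tau>
  proof
    assume "\<tau> ''r'' t \<noteq> 0"
    then show "linked (live \<sigma>) (blocked \<sigma>)"
      using that unfolding linked_def R_def[symmetric] by (simp add: near_def V_def)
  next
    assume "linked (live \<sigma>) (blocked \<sigma>)"
    then have "(s, t) \<in> R\<^sup>*" by (simp add: linked_def R_def)
    moreover have "finite R" using R_as finite_subset by blast
    \<comment> \<open>Reachability in a finite relation needs at most as many steps as it has pairs,
      here at most \<open>m\<close>, the number of rounds.\<close>
    ultimately obtain n where n: "n \<le> card R" "(s, t) \<in> R ^^ n"
      by (auto simp: rtrancl_finite_eq_relpow)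
    have "card R \<le> card (set as)" using R_as by (simp add: card_mono)
    then have "n \<le> m" using n(1) card_length[of as] by linarith
    then show "\<tau> ''r'' t \<noteq> 0" using that n(2) by (simp add: near_def)
  qed
  have 4: "runs (Seq mark_source (For ''i'' (For ''j'' relax))) \<tau>
      (straight_time mark_source + for_time m (for_time m (straight_time relax))) (near m)"
    if "zero m \<tau>" "\<And>A. A \<noteq> ''j'' \<Longrightarrow> A \<noteq> ''r'' \<Longrightarrow> \<tau> A = \<sigma> A" for \<tau>
  proof (rule runs_Seq)
    show "runs mark_source \<tau> (straight_time mark_source)
      (\<lambda>\<mu>. init \<mu> \<and> (\<forall>A. A \<notin> writes mark_source \<longrightarrow> \<mu> A = \<tau> A))"
      by (rule runs_frame, rule 2) (use that in auto)
    fix \<mu> assume "init \<mu> \<and> (\<forall>A. A \<notin> writes mark_source \<longrightarrow> \<mu> A = \<tau> A)"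
    with that(2) show "runs (For ''i'' (For ''j'' relax)) \<mu>
        (for_time m (for_time m (straight_time relax))) (near m)"
      by (intro 3) (simp_all add: mark_source_def)
  qed
  have "runs reach \<sigma> (reach_time m) (near m)"
    unfolding reach_def reach_time_def by (rule runs_Seq[OF runs_frame[OF 1]], rule 4) (simp_all add: clear_ends_def)
  then show ?thesis using fin by (rule runs_weaken[OF _ order_refl])
qed

lemma live_cong: "\<tau> ''a'' = \<sigma> ''a'' \<Longrightarrow> live \<tau> = live \<sigma>"
  by (simp add: live_def)

lemma blocked_cong: "\<tau> ''b'' = \<sigma> ''b'' \<Longrightarrow> blocked \<tau> = blocked \<sigma>"
  by (simp add: blocked_def)

lemma tables_not_writes_cut_search: "A \<in> tables \<Longrightarrow> A \<notin> writes (cut_search k)"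
  by (rule not_writes_cut_search) (auto simp: tables_def)

text \<open>The flag is only ever raised, so a single cell collects the failures from all nested
  loops. That \<open>b\<close> is restored belongs to the claim because the enclosing loop relies on
  it.\<close>

lemma runs_cut_search:
  assumes "stored \<sigma>"
  shows "runs (cut_search k) \<sigma> (cut_search_time k m)
     (\<lambda>\<tau>. (\<tau> ''f'' 0 \<noteq> 0 \<longleftrightarrow> \<sigma> ''f'' 0 \<noteq> 0 \<or> \<not> robust k (live \<sigma>) (blocked \<sigma>)) \<and>
       \<tau> ''b'' = \<sigma> ''b'')"
  using assms
proof (induction k arbitrary: \<sigma>)
  case 0
  show ?case unfolding cut_search.simps cut_search_time.simps
  proof (rule runs_Seq[OF runs_frame[OF runs_reach[OF 0]]])
    fix \<tau> assume \<tau>: "(\<tau> ''r'' t \<noteq> 0 \<longleftrightarrow> linked (live \<sigma>) (blocked \<sigma>)) \<and>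
      (\<forall>A. A \<notin> writes reach \<longrightarrow> \<tau> A = \<sigma> A)"
    then have "\<tau> ''t'' 0 = t" "\<tau> ''f'' = \<sigma> ''f''" "\<tau> ''b'' = \<sigma> ''b''"
      using 0 by (auto simp: stored_def)
    with \<tau> show "runs flag_unreached \<tau> (straight_time flag_unreached)
      (\<lambda>\<tau>. (\<tau> ''f'' 0 \<noteq> 0 \<longleftrightarrow> \<sigma> ''f'' 0 \<noteq> 0 \<or> \<not> robust 0 (live \<sigma>) (blocked \<sigma>)) \<and>
       \<tau> ''b'' = \<sigma> ''b'')"
      by (intro runs_straight while_free_simps) (simp add: flag_unreached_def)
  qed
next
  case (Suc k)
  let ?x = "counter k"
  let ?c = "Seq (block k) (Seq (cut_search k) (unblock k))"
  define found where "found j \<rho> \<longleftrightarrow> (\<rho> ''f'' 0 \<noteq> 0 \<longleftrightarrow> \<sigma> ''f'' 0 \<noteq> 0 \<or>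
      (\<exists>j'<j. \<not> robust k (live \<sigma>) (insert (key (as ! j')) (blocked \<sigma>)))) \<and>
      \<rho> ''b'' = \<sigma> ''b''" for j and \<rho> :: memory
  have x: "?x \<notin> writes ?c"
    using counter_not_writes_cut_search by (simp add: block_def unblock_def)
  have tab: "A \<notin> writes ?c" if "A \<in> tables" for A
    using tables_not_writes_cut_search[OF that] that by (auto simp: block_def unblock_def tables_def)
  have "runs (For ?x ?c) \<sigma> (for_time m (straight_time (block k) +
      (cut_search_time k m + straight_time (unblock k)))) (found m)"
  proof (rule runs_For[where I = found])
    show "\<sigma> ''m'' 0 = m" using Suc.prems by (simp add: stored_def)
    show "?x \<noteq> ''m''" by simp
    show "?x \<notin> writes ?c" by (rule x)
    show "''m'' \<notin> writes ?c" by (rule tab) (simp add: tables_def)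
    show "found 0 (upd ?x 0 0 \<sigma>)" by (simp add: found_def)
    fix j \<rho> assume j: "j < m" "found j \<rho>" "\<rho> ?x 0 = j"
      "\<And>A. A \<noteq> ?x \<Longrightarrow> A \<notin> writes ?c \<Longrightarrow> \<rho> A = \<sigma> A"
    have xt: "?x \<notin> tables" by (auto simp: tables_def)
    have st: "stored \<rho>" using Suc.prems by (rule stored_frame) (use xt tab j(4) in metis)
    define \<kappa> where "\<kappa> = key (as ! j)"
    define \<mu> where "\<mu> = straight (block k) \<rho>"
    have \<mu>: "\<mu> ''b'' = (\<rho> ''b'')(\<kappa> := Suc (\<rho> ''b'' \<kappa>))" "\<And>A. A \<noteq> ''b'' \<Longrightarrow> \<mu> A = \<rho> A"
      using st j(1,3) by (simp_all add: \<mu>_def block_def stored_def \<kappa>_def)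
    have st\<mu>: "stored \<mu>" using st by (rule stored_frame) (rule \<mu>(2), auto simp: tables_def)
    have "\<rho> ''a'' = \<sigma> ''a''"
      by (rule j(4)) (simp_all add: block_def unblock_def not_writes_cut_search)
    then have live: "live \<mu> = live \<sigma>" using \<mu>(2) by (intro live_cong) simp
    have "blocked \<mu> = insert \<kappa> (blocked \<sigma>)"
      using \<mu>(1) j(2) by (auto simp: blocked_def found_def)
    note IH = Suc.IH[OF st\<mu>, unfolded live this]
    have 1: "runs (cut_search k) \<mu> (cut_search_time k m)
      (\<lambda>\<tau>. ((\<tau> ''f'' 0 \<noteq> 0 \<longleftrightarrow> \<mu> ''f'' 0 \<noteq> 0 \<or> \<not> robust k (live \<sigma>) (insert \<kappa> (blocked \<sigma>))) \<and>
        \<tau> ''b'' = \<mu> ''b'') \<and> (\<forall>A. A \<notin> writes (cut_search k) \<longrightarrow> \<tau> A = \<mu> A))"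
      using IH by (rule runs_frame)
    have 2: "runs (unblock k) \<tau> (straight_time (unblock k)) (\<lambda>\<tau>. found (Suc j) (upd ?x 0 (Suc j) \<tau>))"
      if \<tau>: "((\<tau> ''f'' 0 \<noteq> 0 \<longleftrightarrow> \<mu> ''f'' 0 \<noteq> 0 \<or> \<not> robust k (live \<sigma>) (insert \<kappa> (blocked \<sigma>))) \<and>
        \<tau> ''b'' = \<mu> ''b'') \<and> (\<forall>A. A \<notin> writes (cut_search k) \<longrightarrow> \<tau> A = \<mu> A)" for \<tau>
    proof -
      have "stored \<tau>" using st\<mu>
        by (rule stored_frame) (use \<tau> tables_not_writes_cut_search in blast)
      moreover have "\<tau> ?x 0 = j"
        using \<tau> counter_not_writes_cut_search[of k] \<mu>(2)[of ?x] j(3) by simp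
      ultimately have 3: "straight (unblock k) \<tau> ''b'' = (\<tau> ''b'')(\<kappa> := \<tau> ''b'' \<kappa> - 1)"
        "\<And>A. A \<noteq> ''b'' \<Longrightarrow> straight (unblock k) \<tau> A = \<tau> A"
        using j(1) by (simp_all add: unblock_def stored_def \<kappa>_def)
      have "straight (unblock k) \<tau> ''b'' = \<sigma> ''b''"
        using \<tau> \<mu>(1) j(2) by (simp add: 3(1) found_def)
      moreover have "\<mu> ''f'' = \<rho> ''f''" by (rule \<mu>(2)) simp
      moreover have "straight (unblock k) \<tau> ''f'' = \<tau> ''f''" by (rule 3(2)) simp
      ultimately have "found (Suc j) (upd ?x 0 (Suc j) (straight (unblock k) \<tau>))"
        using \<tau> j(2) by (simp add: found_def \<kappa>_def Ex_less_Suc) blast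
      then show ?thesis by (intro runs_straight while_free_simps)
    qed
    have 0: "runs (block k) \<rho> (straight_time (block k)) (\<lambda>\<tau>. \<tau> = \<mu>)"
      unfolding \<mu>_def by (intro runs_straight while_free_simps) simp
    show "runs ?c \<rho> (straight_time (block k) + (cut_search_time k m + straight_time (unblock k)))
      (\<lambda>\<tau>. found (Suc j) (upd ?x 0 (Suc j) \<tau>))"
    proof (rule runs_Seq[OF 0])
      fix \<tau> assume "\<tau> = \<mu>"
      show "runs (Seq (cut_search k) (unblock k)) \<tau> (cut_search_time k m + straight_time (unblock k))
        (\<lambda>\<tau>. found (Suc j) (upd ?x 0 (Suc j) \<tau>))"
        unfolding \<open>\<tau> = \<mu>\<close> by (rule runs_Seq[OF 1 2])
    qed
  qed
  moreover have "(\<tau> ''f'' 0 \<noteq> 0 \<longleftrightarrow> \<sigma> ''f'' 0 \<noteq> 0 \<or> \<not> robust (Suc k) (live \<sigma>) (blocked \<sigma>)) \<and>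
       \<tau> ''b'' = \<sigma> ''b''" if "found m \<tau>" for \<tau>
  proof -
    have "(\<exists>j<m. \<not> robust k (live \<sigma>) (insert (key (as ! j)) (blocked \<sigma>))) \<longleftrightarrow>
      \<not> robust (Suc k) (live \<sigma>) (blocked \<sigma>)" by (simp add: all_set_conv_all_nth)
    then show ?thesis using that by (simp only: found_def)
  qed
  ultimately show ?case unfolding cut_search.simps cut_search_time.simps
    by (simp only: runs_weaken[OF _ order_refl])
qed

lemma runs_check_robust:
  assumes "stored \<sigma>" "blocked \<sigma> = {}"
  shows "runs (check_robust k) \<sigma> (check_robust_time k m)
     (\<lambda>\<tau>. (\<tau> ''f'' 0 \<noteq> 0 \<longleftrightarrow> \<not> robust k (live \<sigma>) {}) \<and> blocked \<tau> = {})"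
  unfolding check_robust_def check_robust_time_def
proof (rule runs_Seq)
  let ?\<mu> = "straight (Assign ''f'' (Num 0) (Num 0)) \<sigma>"
  show "runs (Assign ''f'' (Num 0) (Num 0)) \<sigma> 3 (\<lambda>\<tau>. \<tau> = ?\<mu>)"
    using runs_straight[of "Assign ''f'' (Num 0) (Num 0)" "\<lambda>\<tau>. \<tau> = ?\<mu>" \<sigma>]
    by (simp add: numeral_3_eq_3)
  fix \<tau> assume \<tau>: "\<tau> = ?\<mu>"
  have st: "stored \<tau>" using assms(1) by (rule stored_frame) (auto simp: \<tau> tables_def)
  have live: "live \<tau> = live \<sigma>" by (rule live_cong) (simp add: \<tau>)
  have bl: "blocked \<tau> = {}" unfolding assms(2)[symmetric] by (rule blocked_cong) (simp add: \<tau>)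
  have f: "\<tau> ''f'' 0 = 0" by (simp add: \<tau>)
  show "runs (cut_search k) \<tau> (cut_search_time k m)
     (\<lambda>\<tau>. (\<tau> ''f'' 0 \<noteq> 0 \<longleftrightarrow> \<not> robust k (live \<sigma>) {}) \<and> blocked \<tau> = {})"
  proof (rule runs_weaken[OF runs_cut_search[OF st, of k, unfolded live bl] order_refl])
    fix \<tau>' assume \<tau>': "(\<tau>' ''f'' 0 \<noteq> 0 \<longleftrightarrow> \<tau> ''f'' 0 \<noteq> 0 \<or> \<not> robust k (live \<sigma>) {}) \<and>
      \<tau>' ''b'' = \<tau> ''b''"
    then have "blocked \<tau>' = {}" using blocked_cong[of \<tau>' \<tau>] bl by blast
    with \<tau>' f show "(\<tau>' ''f'' 0 \<noteq> 0 \<longleftrightarrow> \<not> robust k (live \<sigma>) {}) \<and> blocked \<tau>' = {}"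
      by blast
  qed
qed

lemma not_writes_check_robust:
  assumes "A \<noteq> []" "hd A \<noteq> CHR ''x''" "A \<notin> {''r'', ''i'', ''j'', ''f'', ''b''}"
  shows "A \<notin> writes (check_robust k)"
  using not_writes_cut_search[OF assms] assms(3) by (simp add: check_robust_def)

section \<open>Greedy deletion of arcs\<close>

definition minimal_robust :: "nat \<Rightarrow> (nat \<times> nat) set \<Rightarrow> bool" where
  "minimal_robust k S \<longleftrightarrow> robust k S {} \<and> (\<forall>a \<in> S. \<not> robust k (S - {a}) {})"

lemma not_writes_prune:
  assumes "A \<noteq> []" "hd A \<noteq> CHR ''x''" "A \<notin> {''r'', ''i'', ''j'', ''f'', ''b'', ''d'', ''a''}"
  shows "A \<notin> writes (prune k)"
  using not_writes_check_robust[of A] assms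
  by (simp add: prune_def drop_arc_def undrop_arc_def)

text \<open>One pass suffices: an arc that was indispensable when it was examined remains so,
  because arcs only disappear and \<open>robust\<close> is monotone in the set of arcs.\<close>

lemma runs_prune:
  assumes st: "stored \<sigma>" and bl: "blocked \<sigma> = {}" and rob: "robust k (live \<sigma>) {}"
  shows "runs (prune k) \<sigma> (prune_time k m)
     (\<lambda>\<tau>. live \<tau> \<subseteq> live \<sigma> \<and> minimal_robust k (live \<tau>) \<and> blocked \<tau> = {})"
proof -
  let ?c = "Seq drop_arc (Seq (check_robust k) undrop_arc)"
  define pruned where "pruned j \<rho> \<longleftrightarrow> live \<rho> \<subseteq> live \<sigma> \<and> robust k (live \<rho>) {} \<and> blocked \<rho> = {} \<and>
     (\<forall>j'<j. as ! j' \<in> live \<rho> \<longrightarrow> \<not> robust k (live \<rho> - {as ! j'}) {})" for j and \<rho> :: memory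
  have "runs (prune k) \<sigma> (prune_time k m) (pruned m)"
    unfolding prune_def prune_time_def
  proof (rule runs_For[where I = pruned])
    show "\<sigma> ''m'' 0 = m" using st by (simp add: stored_def)
    show "''d'' \<noteq> ''m''" "''d'' \<notin> writes ?c" "''m'' \<notin> writes ?c"
      by (simp_all add: drop_arc_def undrop_arc_def not_writes_check_robust)
    show "pruned 0 (upd ''d'' 0 0 \<sigma>)"
      using rob bl by (simp add: pruned_def live_def blocked_def)
    fix j \<rho> assume j: "j < m" "pruned j \<rho>" "\<rho> ''d'' 0 = j"
      "\<And>A. A \<noteq> ''d'' \<Longrightarrow> A \<notin> writes ?c \<Longrightarrow> \<rho> A = \<sigma> A"
    have st\<rho>: "stored \<rho>" using st
      by (rule stored_frame, intro j(4))
         (auto simp: tables_def drop_arc_def undrop_arc_def not_writes_check_robust)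
    define \<mu> where "\<mu> = straight drop_arc \<rho>"
    have \<mu>: "\<mu> ''a'' = (\<rho> ''a'')(j := 0)" "\<And>A. A \<noteq> ''a'' \<Longrightarrow> \<mu> A = \<rho> A"
      using j(3) by (simp_all add: \<mu>_def drop_arc_def)
    have st\<mu>: "stored \<mu>" using st\<rho> by (rule stored_frame) (rule \<mu>(2), auto simp: tables_def)
    have live\<mu>: "live \<mu> = live \<rho> - {as ! j}"
      using \<mu>(1) j(1) distinct_arcs by (auto simp: live_def nth_eq_iff_index_eq)
    have "blocked \<mu> = blocked \<rho>" by (rule blocked_cong) (rule \<mu>(2), simp)
    then have bl\<mu>: "blocked \<mu> = {}" using j(2) by (simp add: pruned_def)
    have 0: "runs drop_arc \<rho> (straight_time drop_arc) (\<lambda>\<tau>. \<tau> = \<mu>)"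
      unfolding \<mu>_def by (intro runs_straight while_free_simps) simp
    have 1: "runs (check_robust k) \<mu> (check_robust_time k m)
      (\<lambda>\<tau>. ((\<tau> ''f'' 0 \<noteq> 0 \<longleftrightarrow> \<not> robust k (live \<rho> - {as ! j}) {}) \<and> blocked \<tau> = {}) \<and>
        (\<forall>A. A \<notin> writes (check_robust k) \<longrightarrow> \<tau> A = \<mu> A))"
      using runs_check_robust[OF st\<mu> bl\<mu>, of k, unfolded live\<mu>] by (rule runs_frame)
    have 2: "runs undrop_arc \<tau> (straight_time undrop_arc) (\<lambda>\<tau>. pruned (Suc j) (upd ''d'' 0 (Suc j) \<tau>))"
      if \<tau>: "((\<tau> ''f'' 0 \<noteq> 0 \<longleftrightarrow> \<not> robust k (live \<rho> - {as ! j}) {}) \<and> blocked \<tau> = {}) \<and>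
        (\<forall>A. A \<notin> writes (check_robust k) \<longrightarrow> \<tau> A = \<mu> A)" for \<tau>
    proof -
      have "\<tau> ''d'' = \<mu> ''d''" "\<tau> ''a'' = \<mu> ''a''"
        using \<tau> by (simp_all add: not_writes_check_robust)
      then have \<tau>': "\<tau> ''d'' 0 = j" "\<tau> ''a'' = (\<rho> ''a'')(j := 0)" using \<mu> j(3) by simp_all
      define \<nu> where "\<nu> = upd ''d'' 0 (Suc j) (straight undrop_arc \<tau>)"
      have \<nu>: "\<nu> ''a'' = (if robust k (live \<rho> - {as ! j}) {} then \<tau> ''a'' else (\<tau> ''a'')(j := 1))"
        "\<nu> ''b'' = \<tau> ''b''"
        using \<tau> \<tau>'(1) by (auto simp: \<nu>_def undrop_arc_def)
      have bl\<nu>: "blocked \<nu> = {}" using \<tau> blocked_cong[of \<nu> \<tau>] \<nu>(2) by blast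
      have "pruned (Suc j) \<nu>"
      proof (cases "robust k (live \<rho> - {as ! j}) {}")
        case True
        have "\<nu> ''a'' = \<mu> ''a''" using True by (simp add: \<nu>(1) \<tau>'(2) \<mu>(1))
        then have live\<nu>: "live \<nu> = live \<rho> - {as ! j}" using live\<mu> live_cong by metis
        have "\<not> robust k (live \<rho> - {as ! j} - {as ! j'}) {}"
          if "j' < Suc j" "as ! j' \<in> live \<rho> - {as ! j}" for j'
        proof
          assume "robust k (live \<rho> - {as ! j} - {as ! j'}) {}"
          then have "robust k (live \<rho> - {as ! j'}) {}" by (rule robust_mono) blast
          moreover have "j' \<noteq> j" using that(2) by blast
          ultimately show False using that j(2) by (simp add: pruned_def)
        qed
        then show ?thesis using True j(2) bl\<nu> unfolding pruned_def live\<nu> by blast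
      next
        case False
        \<comment> \<open>\<open>undrop_arc\<close> must not revive an arc that was dead before. It
          does not: dropping a dead arc changes nothing, so the test would have succeeded.\<close>
        have "as ! j \<in> live \<rho>"
        proof (rule ccontr)
          assume "as ! j \<notin> live \<rho>"
          then have "live \<rho> - {as ! j} = live \<rho>" by blast
          then show False using False j(2) by (simp add: pruned_def)
        qed
        then have "\<rho> ''a'' j \<noteq> 0" using j(1) by (simp add: nth_in_live)
        moreover have "\<nu> ''a'' = (\<rho> ''a'')(j := 1)" using False by (simp add: \<nu>(1) \<tau>'(2))
        ultimately have live\<nu>: "live \<nu> = live \<rho>" by (auto simp: live_def)
        have "\<not> robust k (live \<rho> - {as ! j'}) {}" if "j' < Suc j" "as ! j' \<in> live \<rho>" for j'
          using that j(2) False by (cases "j' = j") (simp_all add: pruned_def)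
        then show ?thesis using j(2) bl\<nu> unfolding pruned_def live\<nu> by blast
      qed
      then show ?thesis unfolding \<nu>_def by (intro runs_straight while_free_simps)
    qed
    show "runs ?c \<rho> (straight_time drop_arc + (check_robust_time k m + straight_time undrop_arc))
      (\<lambda>\<tau>. pruned (Suc j) (upd ''d'' 0 (Suc j) \<tau>))"
    proof (rule runs_Seq[OF 0])
      fix \<tau> assume "\<tau> = \<mu>"
      show "runs (Seq (check_robust k) undrop_arc) \<tau> (check_robust_time k m + straight_time undrop_arc)
        (\<lambda>\<tau>. pruned (Suc j) (upd ''d'' 0 (Suc j) \<tau>))"
        unfolding \<open>\<tau> = \<mu>\<close> by (rule runs_Seq[OF 1 2])
    qed
  qed
  moreover have "live \<tau> \<subseteq> live \<sigma> \<and> minimal_robust k (live \<tau>) \<and> blocked \<tau> = {}"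
    if "pruned m \<tau>" for \<tau>
    using that live_subset[of \<tau>] unfolding pruned_def minimal_robust_def
    by (metis in_set_conv_nth subsetD)
  ultimately show ?thesis by (simp only: runs_weaken[OF _ order_refl])
qed

section \<open>The best uniform flow found so far\<close>

definition wide :: "nat \<Rightarrow> (nat \<times> nat) set" where
  "wide r = {a \<in> set as. r \<le> cap a}"

text \<open>Without arcs, \<open>robust (Suc k)\<close> holds vacuously, hence the condition \<open>as \<noteq> []\<close>.\<close>

definition solution :: "nat \<Rightarrow> nat \<Rightarrow> (nat \<Rightarrow> nat) \<Rightarrow> bool" where
  "solution p b x \<longleftrightarrow> (b = 0 \<and> (\<forall>j<m. x j = 0)) \<or>
     (as \<noteq> [] \<and> (\<exists>k<p. \<exists>r S. S \<subseteq> wide r \<and> minimal_robust k S \<and> b = Suc k * r \<and>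
        (\<forall>j<m. x j = (if as ! j \<in> S then r else 0))))"

text \<open>The trial with \<open>Suc k\<close> paths and the capacity of arc \<open>j\<close> is
  accounted for by the value \<open>b\<close>. These facts for all trials are what the upper bound
  on the optimum uses.\<close>

definition covered :: "nat \<Rightarrow> nat \<Rightarrow> nat \<Rightarrow> bool" where
  "covered k j b \<longleftrightarrow> (robust k (wide (cap (as ! j))) {} \<longrightarrow> Suc k * cap (as ! j) \<le> b)"

lemma solution_mono:
  assumes "solution p b x" "p \<le> q"
  shows "solution q b x"
proof -
  have "k < q" if "k < p" for k using that assms(2) by simp
  then show ?thesis using assms(1) unfolding solution_def by blast
qed

lemma covered_mono: "covered k j b \<Longrightarrow> b \<le> b' \<Longrightarrow> covered k j b'"
  unfolding covered_def by (meson le_trans)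

lemma not_writes_record_flow:
  assumes "A \<noteq> []" "hd A \<noteq> CHR ''x''"
    "A \<notin> {''r'', ''i'', ''j'', ''f'', ''b'', ''d'', ''a'', ''l'', ''out'', ''w''}"
  shows "A \<notin> writes (record_flow k)"
  using not_writes_prune[of A] assms by (simp add: record_flow_def write_flow_def set_best_def)

lemma not_writes_improve:
  assumes "A \<noteq> []" "hd A \<noteq> CHR ''x''"
    "A \<notin> {''r'', ''i'', ''j'', ''f'', ''b'', ''d'', ''a'', ''l'', ''out'', ''w''}"
  shows "A \<notin> writes (improve k)"
  using not_writes_check_robust[of A] not_writes_record_flow[OF assms] assms
  by (simp add: improve_def select_wide_def)

text \<open>Pruning only deletes arcs, so the remaining ones are still wide enough for the amount
  that is written.\<close>

lemma runs_record_flow: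
  assumes st: "stored \<sigma>" and bl: "blocked \<sigma> = {}" and rob: "robust k (live \<sigma>) {}"
    and e: "\<sigma> ''e'' 0 = e" "e < m" and sub: "live \<sigma> \<subseteq> wide (cap (as ! e))" and k: "k < p"
  shows "runs (record_flow k) \<sigma> (record_flow_time k m)
     (\<lambda>\<tau>. blocked \<tau> = {} \<and> \<tau> ''w'' 0 = Suc k * cap (as ! e) \<and> solution p (\<tau> ''w'' 0) (\<tau> ''out''))"
  unfolding record_flow_def record_flow_time_def
proof (rule runs_Seq[OF runs_frame[OF runs_prune[OF st bl rob]]])
  let ?r = "cap (as ! e)"
  fix \<tau> assume \<tau>: "(live \<tau> \<subseteq> live \<sigma> \<and> minimal_robust k (live \<tau>) \<and> blocked \<tau> = {}) \<and>
    (\<forall>A. A \<notin> writes (prune k) \<longrightarrow> \<tau> A = \<sigma> A)"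
  have st\<tau>: "stored \<tau>" using st
    by (rule stored_frame) (use \<tau> in \<open>auto simp: tables_def not_writes_prune\<close>)
  have e\<tau>: "\<tau> ''e'' 0 = e" using \<tau> e(1) by (simp add: not_writes_prune)
  define written where "written j \<rho> \<longleftrightarrow>
    (\<forall>j'<j. \<rho> ''out'' j' = (if as ! j' \<in> live \<tau> then ?r else 0))" for j and \<rho> :: memory
  have 1: "runs (For ''l'' write_flow) \<tau> (for_time m (straight_time write_flow)) (written m)"
  proof (rule runs_For[where I = written])
    show "\<tau> ''m'' 0 = m" using st\<tau> by (simp add: stored_def)
    show "''l'' \<noteq> ''m''" "''l'' \<notin> writes write_flow" "''m'' \<notin> writes write_flow"
      by (simp_all add: write_flow_def)
    show "written 0 (upd ''l'' 0 0 \<tau>)" by (simp add: written_def)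
    fix j \<rho> assume j: "j < m" "written j \<rho>" "\<rho> ''l'' 0 = j"
      "\<And>A. A \<noteq> ''l'' \<Longrightarrow> A \<notin> writes write_flow \<Longrightarrow> \<rho> A = \<tau> A"
    have "\<rho> ''c'' = \<tau> ''c''" "\<rho> ''e'' = \<tau> ''e''" "\<rho> ''a'' = \<tau> ''a''"
      by (rule j(4); simp add: write_flow_def)+
    then have "\<rho> ''c'' e = ?r" "\<rho> ''e'' 0 = e" "\<rho> ''a'' j \<noteq> 0 \<longleftrightarrow> as ! j \<in> live \<tau>"
      using st\<tau> e(2) e\<tau> nth_in_live[OF j(1), of \<tau>] by (simp_all add: stored_def)
    then have "straight write_flow \<rho> ''out'' = (\<rho> ''out'')(j := if as ! j \<in> live \<tau> then ?r else 0)"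
      using j(3) by (simp add: write_flow_def)
    then have "written (Suc j) (upd ''l'' 0 (Suc j) (straight write_flow \<rho>))"
      using j(2) by (simp add: written_def All_less_Suc)
    then show "runs write_flow \<rho> (straight_time write_flow)
        (\<lambda>\<tau>. written (Suc j) (upd ''l'' 0 (Suc j) \<tau>))"
      by (intro runs_straight while_free_simps)
  qed
  show "runs (Seq (For ''l'' write_flow) (set_best k)) \<tau>
     (for_time m (straight_time write_flow) + straight_time (set_best k))
     (\<lambda>\<tau>. blocked \<tau> = {} \<and> \<tau> ''w'' 0 = Suc k * ?r \<and> solution p (\<tau> ''w'' 0) (\<tau> ''out''))"
  proof (rule runs_Seq[OF runs_frame[OF 1]])
    fix \<rho> assume \<rho>: "written m \<rho> \<and> (\<forall>A. A \<notin> writes (For ''l'' write_flow) \<longrightarrow> \<rho> A = \<tau> A)"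
    define \<mu> where "\<mu> = straight (set_best k) \<rho>"
    have "\<rho> ''c'' = \<tau> ''c''" "\<rho> ''e'' = \<tau> ''e''" "\<rho> ''b'' = \<tau> ''b''"
      using \<rho> by (simp_all add: write_flow_def)
    then have "\<mu> ''w'' 0 = Suc k * ?r" "\<mu> ''out'' = \<rho> ''out''" "\<mu> ''b'' = \<tau> ''b''"
      using st\<tau> e(2) e\<tau> by (simp_all add: \<mu>_def set_best_def stored_def)
    moreover from this have "blocked \<mu> = {}" using blocked_cong[of \<mu> \<tau>] \<tau> by blast
    moreover have "solution p (Suc k * ?r) (\<rho> ''out'')"
      unfolding solution_def
    proof (intro disjI2 exI conjI)
      show "as \<noteq> []" using e(2) by auto
      show "live \<tau> \<subseteq> wide ?r" using \<tau> sub by blast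
      show "minimal_robust k (live \<tau>)" using \<tau> by blast
      show "\<forall>j<m. \<rho> ''out'' j = (if as ! j \<in> live \<tau> then ?r else 0)"
        using \<rho> by (simp add: written_def)
    qed (use k in simp_all)
    ultimately have "blocked (straight (set_best k) \<rho>) = {} \<and>
        straight (set_best k) \<rho> ''w'' 0 = Suc k * ?r \<and>
        solution p (straight (set_best k) \<rho> ''w'' 0) (straight (set_best k) \<rho> ''out'')"
      unfolding \<mu>_def by metis
    then show "runs (set_best k) \<rho> (straight_time (set_best k))
     (\<lambda>\<tau>. blocked \<tau> = {} \<and> \<tau> ''w'' 0 = Suc k * ?r \<and> solution p (\<tau> ''w'' 0) (\<tau> ''out''))"
      by (intro runs_straight while_free_simps)
  qed
qed

lemma runs_select_wide:
  assumes st: "stored \<sigma>" and e: "\<sigma> ''e'' 0 = e" "e < m"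
  shows "runs (For ''l'' select_wide) \<sigma> (for_time m (straight_time select_wide))
     (\<lambda>\<tau>. live \<tau> = wide (cap (as ! e)))"
proof -
  define sel where "sel j \<rho> \<longleftrightarrow>
    (\<forall>j'<j. \<rho> ''a'' j' = 1 - (cap (as ! e) - cap (as ! j')))" for j and \<rho> :: memory
  have "runs (For ''l'' select_wide) \<sigma> (for_time m (straight_time select_wide)) (sel m)"
  proof (rule runs_For[where I = sel])
    show "\<sigma> ''m'' 0 = m" using st by (simp add: stored_def)
    show "''l'' \<noteq> ''m''" "''l'' \<notin> writes select_wide" "''m'' \<notin> writes select_wide"
      by (simp_all add: select_wide_def)
    show "sel 0 (upd ''l'' 0 0 \<sigma>)" by (simp add: sel_def)
    fix j \<rho> assume j: "j < m" "sel j \<rho>" "\<rho> ''l'' 0 = j"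
      "\<And>A. A \<noteq> ''l'' \<Longrightarrow> A \<notin> writes select_wide \<Longrightarrow> \<rho> A = \<sigma> A"
    have "\<rho> ''c'' = \<sigma> ''c''" "\<rho> ''e'' = \<sigma> ''e''"
      by (rule j(4); simp add: select_wide_def)+
    then have "straight select_wide \<rho> ''a'' = (\<rho> ''a'')(j := 1 - (cap (as ! e) - cap (as ! j)))"
      using j(1,3) st e by (simp add: select_wide_def stored_def)
    then have "sel (Suc j) (upd ''l'' 0 (Suc j) (straight select_wide \<rho>))"
      using j(2) by (simp add: sel_def All_less_Suc)
    then show "runs select_wide \<rho> (straight_time select_wide)
        (\<lambda>\<tau>. sel (Suc j) (upd ''l'' 0 (Suc j) \<tau>))"
      by (intro runs_straight while_free_simps)
  qed
  moreover have "live \<tau> = wide (cap (as ! e))" if "sel m \<tau>" for \<tau>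
  proof -
    have "\<tau> ''a'' j \<noteq> 0 \<longleftrightarrow> cap (as ! e) \<le> cap (as ! j)" if "j < m" for j
      using \<open>sel m \<tau>\<close> that by (auto simp: sel_def)
    then show ?thesis by (auto simp: live_def wide_def set_conv_nth)
  qed
  ultimately show ?thesis by (simp only: runs_weaken[OF _ order_refl])
qed

text \<open>A trial is covered in each case: its value was already reached, or there is a cut, or
  its flow has just been recorded. That the best value never decreases preserves the trials covered
  earlier.\<close>

lemma runs_improve:
  assumes st: "stored \<sigma>" and bl: "blocked \<sigma> = {}" and sol: "solution p (\<sigma> ''w'' 0) (\<sigma> ''out'')"
    and e: "\<sigma> ''e'' 0 = e" "e < m" and k: "k < p"
  shows "runs (improve k) \<sigma> (improve_time k m)
     (\<lambda>\<tau>. blocked \<tau> = {} \<and> \<sigma> ''w'' 0 \<le> \<tau> ''w'' 0 \<and> solution p (\<tau> ''w'' 0) (\<tau> ''out'') \<and>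
       covered k e (\<tau> ''w'' 0))" (is "runs _ _ _ ?Q")
proof -
  let ?r = "cap (as ! e)"
  have r: "\<sigma> ''c'' (\<sigma> ''e'' 0) = ?r" using st e by (simp add: stored_def)
  let ?T = "for_time m (straight_time select_wide) +
      (check_robust_time k m + (3 + record_flow_time k m))"
  let ?b = "Sub (times (Suc k) (item ''c'' ''e'')) (var ''w'')"
  have skip: "runs Skip \<sigma> ?T ?Q" if "eval_expr ?b \<sigma> = 0"
  proof -
    have "Suc k * ?r \<le> \<sigma> ''w'' 0" using that r by simp
    then have q: "?Q \<sigma>" using bl sol by (simp add: covered_def)
    show ?thesis by (rule runs_Skip_le[where Q = ?Q, OF q]) (simp add: for_time_def)
  qed
  have main: "runs (Seq (For ''l'' select_wide)
      (Seq (check_robust k) (Cond (var ''f'') Skip (record_flow k)))) \<sigma> ?T ?Q"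
    if "eval_expr ?b \<sigma> \<noteq> 0"
  proof -
    have "Suc k * ?r - \<sigma> ''w'' 0 \<noteq> 0"
      using that by (simp only: eval_expr.simps eval_times r not_False_eq_True)
    then have better: "\<sigma> ''w'' 0 \<le> Suc k * ?r" by (cases "\<sigma> ''w'' 0 \<le> Suc k * ?r") simp_all
    note sel = runs_frame[OF runs_select_wide[where \<sigma> = \<sigma> and e = e, OF st e]]
    show ?thesis
    proof (rule runs_Seq[OF sel])
      fix \<tau> assume \<tau>: "live \<tau> = wide ?r \<and>
        (\<forall>A. A \<notin> writes (For ''l'' select_wide) \<longrightarrow> \<tau> A = \<sigma> A)"
      have frame: "\<tau> A = \<sigma> A" if "A \<noteq> ''l''" "A \<noteq> ''a''" for A
        using \<tau> that by (simp add: select_wide_def)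
      have st\<tau>: "stored \<tau>" using st
        by (rule stored_frame) (rule frame; auto simp: tables_def)
      have "\<tau> ''b'' = \<sigma> ''b''" by (simp add: frame)
      then have bl\<tau>: "blocked \<tau> = {}" using blocked_cong[of \<tau> \<sigma>] bl by blast
      show "runs (Seq (check_robust k) (Cond (var ''f'') Skip (record_flow k))) \<tau>
         (check_robust_time k m + (3 + record_flow_time k m)) ?Q"
      proof (rule runs_Seq[OF runs_frame[OF runs_check_robust[OF st\<tau> bl\<tau>]]])
        fix \<rho> assume \<rho>: "((\<rho> ''f'' 0 \<noteq> 0 \<longleftrightarrow> \<not> robust k (live \<tau>) {}) \<and> blocked \<rho> = {}) \<and>
          (\<forall>A. A \<notin> writes (check_robust k) \<longrightarrow> \<rho> A = \<tau> A)"
        have st\<rho>: "stored \<rho>" using st\<tau>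
          by (rule stored_frame) (use \<rho> in \<open>auto simp: tables_def not_writes_check_robust\<close>)
        have same: "\<rho> ''a'' = \<tau> ''a''" "\<rho> ''e'' = \<sigma> ''e''" "\<rho> ''w'' = \<sigma> ''w''" "\<rho> ''out'' = \<sigma> ''out''"
          using \<rho> by (simp_all add: not_writes_check_robust frame)
        have live\<rho>: "live \<rho> = wide ?r" using \<tau> live_cong[of \<rho> \<tau>] same(1) by simp
        have "runs (Cond (var ''f'') Skip (record_flow k)) \<rho>
          (expr_cost (var ''f'') + 1 + record_flow_time k m) ?Q"
        proof (rule runs_Cond)
          assume "eval_expr (var ''f'') \<rho> \<noteq> 0"
          then have "\<not> robust k (wide ?r) {}" using \<rho> \<tau> by simp
          then have q: "?Q \<rho>" using \<rho> same sol by (simp add: covered_def)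
          show "runs Skip \<rho> (record_flow_time k m) ?Q"
            by (rule runs_Skip_le[where Q = ?Q, OF q]) (simp add: record_flow_time_def for_time_def)
        next
          assume "eval_expr (var ''f'') \<rho> = 0"
          then have rob: "robust k (live \<rho>) {}" using \<rho> \<tau> live\<rho> by simp
          have bl\<rho>: "blocked \<rho> = {}" using \<rho> by blast
          have e\<rho>: "\<rho> ''e'' 0 = e" using e same by simp
          have sub: "live \<rho> \<subseteq> wide ?r" using live\<rho> by simp
          show "runs (record_flow k) \<rho> (record_flow_time k m) ?Q"
          proof (rule runs_weaken[OF runs_record_flow[where \<sigma> = \<rho> and e = e, OF st\<rho> bl\<rho> rob e\<rho> e(2) sub k] order_refl])
            fix \<mu> assume \<mu>: "blocked \<mu> = {} \<and> \<mu> ''w'' 0 = Suc k * ?r \<and> solution p (\<mu> ''w'' 0) (\<mu> ''out'')"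
            have "covered k e (Suc k * ?r)" by (simp add: covered_def)
            then show "?Q \<mu>" using better \<mu> by metis
          qed
        qed
        moreover have "expr_cost (var ''f'') + 1 + record_flow_time k m = 3 + record_flow_time k m"
          by simp
        ultimately show "runs (Cond (var ''f'') Skip (record_flow k)) \<rho> (3 + record_flow_time k m) ?Q"
          by (simp only:)
      qed
    qed
  qed
  show ?thesis unfolding improve_def improve_time_def by (rule runs_Cond[OF main skip])
qed

lemma not_writes_optimize:
  assumes "A \<noteq> []" "hd A \<noteq> CHR ''x''"
    "A \<notin> {''r'', ''i'', ''j'', ''f'', ''b'', ''d'', ''a'', ''l'', ''out'', ''w'', ''e''}"
  shows "A \<notin> writes (optimize p)"
  using assms by (induction p) (simp_all add: not_writes_improve)

lemma runs_optimize:
  assumes "stored \<sigma>" "blocked \<sigma> = {}" "\<sigma> ''w'' 0 = 0" "\<And>j. \<sigma> ''out'' j = 0"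
  shows "runs (optimize p) \<sigma> (optimize_time p m)
     (\<lambda>\<tau>. blocked \<tau> = {} \<and> solution p (\<tau> ''w'' 0) (\<tau> ''out'') \<and>
       (\<forall>k<p. \<forall>e<m. covered k e (\<tau> ''w'' 0)))"
proof (induction p)
  case 0
  have "solution 0 (\<sigma> ''w'' 0) (\<sigma> ''out'')" using assms by (simp add: solution_def)
  then show ?case using assms(2) unfolding optimize.simps optimize_time.simps by (intro runs_Skip_le) simp_all
next
  case (Suc k)
  show ?case unfolding optimize.simps optimize_time.simps
  proof (rule runs_Seq[OF runs_frame[OF Suc.IH]])
    fix \<tau> assume \<tau>: "(blocked \<tau> = {} \<and> solution k (\<tau> ''w'' 0) (\<tau> ''out'') \<and>
       (\<forall>k'<k. \<forall>e<m. covered k' e (\<tau> ''w'' 0))) \<and> (\<forall>A. A \<notin> writes (optimize k) \<longrightarrow> \<tau> A = \<sigma> A)"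
    have st: "stored \<tau>" using assms(1)
      by (rule stored_frame) (use \<tau> in \<open>auto simp: tables_def not_writes_optimize\<close>)
    define improved where "improved e \<rho> \<longleftrightarrow> blocked \<rho> = {} \<and> solution (Suc k) (\<rho> ''w'' 0) (\<rho> ''out'') \<and>
       (\<forall>k'<k. \<forall>e<m. covered k' e (\<rho> ''w'' 0)) \<and> (\<forall>e'<e. covered k e' (\<rho> ''w'' 0))"
      for e and \<rho> :: memory
    have upd_e: "improved n (upd ''e'' 0 i \<rho>) \<longleftrightarrow> improved n \<rho>" for n i \<rho>
      by (simp add: improved_def blocked_def)
    have "runs (For ''e'' (improve k)) \<tau> (for_time m (improve_time k m)) (improved m)"
    proof (rule runs_For[where I = improved])
      show "\<tau> ''m'' 0 = m" using st by (simp add: stored_def)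
      show "''e'' \<noteq> ''m''" "''e'' \<notin> writes (improve k)" "''m'' \<notin> writes (improve k)"
        by (simp_all add: not_writes_improve)
      show "improved 0 (upd ''e'' 0 0 \<tau>)"
        using \<tau> solution_mono[of k _ _ "Suc k"] by (simp add: upd_e) (simp add: improved_def)
      fix e \<rho> assume e: "e < m" "improved e \<rho>" "\<rho> ''e'' 0 = e"
        "\<And>A. A \<noteq> ''e'' \<Longrightarrow> A \<notin> writes (improve k) \<Longrightarrow> \<rho> A = \<tau> A"
      have st\<rho>: "stored \<rho>" using st
        by (rule stored_frame, intro e(4)) (auto simp: tables_def not_writes_improve)
      have bl: "blocked \<rho> = {}" and sol: "solution (Suc k) (\<rho> ''w'' 0) (\<rho> ''out'')"
        using e(2) by (simp_all add: improved_def)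
      show "runs (improve k) \<rho> (improve_time k m) (\<lambda>\<tau>. improved (Suc e) (upd ''e'' 0 (Suc e) \<tau>))"
        unfolding upd_e
      proof (rule runs_weaken[OF runs_improve[where \<sigma> = \<rho> and e = e, OF st\<rho> bl sol e(3,1) lessI] order_refl])
        fix \<mu> assume \<mu>: "blocked \<mu> = {} \<and> \<rho> ''w'' 0 \<le> \<mu> ''w'' 0 \<and>
          solution (Suc k) (\<mu> ''w'' 0) (\<mu> ''out'') \<and> covered k e (\<mu> ''w'' 0)"
        have "covered k' e' (\<mu> ''w'' 0)" if "covered k' e' (\<rho> ''w'' 0)" for k' e'
          using that \<mu> covered_mono by blast
        then show "improved (Suc e) \<mu>" using e(2) \<mu> by (simp add: improved_def All_less_Suc)
      qed
    qed
    then show "runs (For ''e'' (improve k)) \<tau> (for_time m (improve_time k m))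
      (\<lambda>\<tau>. blocked \<tau> = {} \<and> solution (Suc k) (\<tau> ''w'' 0) (\<tau> ''out'') \<and>
       (\<forall>k'<Suc k. \<forall>e<m. covered k' e (\<tau> ''w'' 0)))"
      by (rule runs_weaken[OF _ order_refl]) (simp add: improved_def All_less_Suc)
  qed
qed

end

section \<open>Reading the input\<close>

lemma length_concat_triples: "length (concat (map (\<lambda>a. [f a, g a, h a]) xs)) = 3 * length xs"
  by (induction xs) auto

lemma nth_concat_triples:
  assumes "j < length xs"
  shows "concat (map (\<lambda>a. [f a, g a, h a]) xs) ! (3 * j) = f (xs ! j)"
    and "concat (map (\<lambda>a. [f a, g a, h a]) xs) ! (3 * j + 1) = g (xs ! j)"
    and "concat (map (\<lambda>a. [f a, g a, h a]) xs) ! (3 * j + 2) = h (xs ! j)"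
  using assms
proof (induction xs arbitrary: j)
  case (Cons a xs)
  {
    case 1 then show ?case using Cons.IH(1)[of "j - 1"] by (cases j) auto
  next
    case 2 then show ?case using Cons.IH(2)[of "j - 1"] by (cases j) auto
  next
    case 3 then show ?case using Cons.IH(3)[of "j - 1"] by (cases j) (auto simp: eval_nat_numeral)
  }
qed auto

context arc_table
begin

text \<open>Specifies the only command in which the two algorithms differ. It runs right after arc
  \<open>j\<close> has been loaded, when its head, the number of arcs and the sink are
  available.\<close>

definition sets_key :: "program \<Rightarrow> bool" where
  "sets_key c \<longleftrightarrow> while_free c \<and> writes c = {''k''} \<and>
     (\<forall>\<rho> j. j < m \<longrightarrow> \<rho> ''l'' 0 = j \<longrightarrow> \<rho> ''v'' j = snd (as ! j) \<longrightarrow> \<rho> ''m'' 0 = m \<longrightarrow>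
        \<rho> ''t'' 0 = t \<longrightarrow> straight c \<rho> ''k'' = (\<rho> ''k'')(j := key (as ! j)))"

definition encoding :: "nat list \<Rightarrow> nat list" where
  "encoding vs = [length vs, m, s, t] @ vs @ concat (map (\<lambda>a. [fst a, snd a, cap a]) as)"

lemma length_encoding: "length (encoding vs) = 4 + length vs + 3 * m"
  by (simp add: encoding_def length_concat_triples)

lemma nth_encoding:
  "encoding vs ! 0 = length vs" "encoding vs ! 1 = m" "encoding vs ! 2 = s" "encoding vs ! 3 = t"
  "j < m \<Longrightarrow> encoding vs ! (4 + length vs + 3 * j) = fst (as ! j)"
  "j < m \<Longrightarrow> encoding vs ! (4 + length vs + 3 * j + 1) = snd (as ! j)"
  "j < m \<Longrightarrow> encoding vs ! (4 + length vs + 3 * j + 2) = cap (as ! j)"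
proof -
  have app: "encoding vs ! (4 + length vs + q) = concat (map (\<lambda>a. [fst a, snd a, cap a]) as) ! q" for q
    using nth_append_length_plus[of "[length vs, m, s, t] @ vs" _ q]
    by (simp add: encoding_def)
  show "encoding vs ! 0 = length vs" "encoding vs ! 1 = m" "encoding vs ! 2 = s" "encoding vs ! 3 = t"
    by (simp_all add: encoding_def eval_nat_numeral)
  assume j: "j < m"
  show "encoding vs ! (4 + length vs + 3 * j) = fst (as ! j)"
    by (simp only: app nth_concat_triples[OF j])
  show "encoding vs ! (4 + length vs + 3 * j + 1) = snd (as ! j)"
    using app[of "3 * j + 1"] nth_concat_triples(2)[OF j, of fst snd cap] by (simp add: add.assoc)
  show "encoding vs ! (4 + length vs + 3 * j + 2) = cap (as ! j)"
    using app[of "3 * j + 2"] nth_concat_triples(3)[OF j, of fst snd cap] by (simp add: add.assoc)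
qed

lemma runs_load:
  assumes key: "sets_key c"
    and \<sigma>: "\<sigma> ''m'' 0 = m" "\<sigma> ''s'' 0 = s" "\<sigma> ''t'' 0 = t" "\<sigma> ''p'' 0 = 4 + length vs"
      "\<And>i. i < length (encoding vs) \<Longrightarrow> \<sigma> ''in'' i = encoding vs ! i"
  shows "runs (For ''l'' (Seq load_arc c)) \<sigma> (for_time m (straight_time (Seq load_arc c))) stored"
proof -
  let ?c = "Seq load_arc c"
  have c: "while_free c" "writes c = {''k''}" using key by (simp_all add: sets_key_def)
  have w: "writes ?c = {''u'', ''v'', ''c'', ''p'', ''k''}" by (auto simp: c load_arc_def)
  define loaded where "loaded j \<rho> \<longleftrightarrow> \<rho> ''p'' 0 = 4 + length vs + 3 * j \<and>
    (\<forall>j'<j. \<rho> ''u'' j' = fst (as ! j') \<and> \<rho> ''v'' j' = snd (as ! j') \<and>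
        \<rho> ''c'' j' = cap (as ! j') \<and> \<rho> ''k'' j' = key (as ! j'))" for j and \<rho> :: memory
  have run: "runs (For ''l'' ?c) \<sigma> (for_time m (straight_time ?c)) (loaded m)"
  proof (rule runs_For[where I = loaded])
    show "\<sigma> ''m'' 0 = m" by (rule \<sigma>(1))
    show "''l'' \<noteq> ''m''" "''l'' \<notin> writes ?c" "''m'' \<notin> writes ?c" by (simp_all add: w del: writes.simps)
    show "loaded 0 (upd ''l'' 0 0 \<sigma>)" using \<sigma>(4) by (simp add: loaded_def)
    fix j \<rho> assume j: "j < m" "loaded j \<rho>" "\<rho> ''l'' 0 = j"
      "\<And>A. A \<noteq> ''l'' \<Longrightarrow> A \<notin> writes ?c \<Longrightarrow> \<rho> A = \<sigma> A"
    have frame: "\<rho> ''in'' = \<sigma> ''in''" "\<rho> ''m'' = \<sigma> ''m''" "\<rho> ''t'' = \<sigma> ''t''"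
      by (rule j(4); simp add: w del: writes.simps)+
    let ?i = "4 + length vs + 3 * j"
    have len: "?i + 2 < length (encoding vs)" using j(1) by (simp add: length_encoding)
    have p: "\<rho> ''p'' 0 = ?i" using j(2) by (simp add: loaded_def)
    have "\<rho> ''in'' i = encoding vs ! i" if "i \<le> ?i + 2" for i
      unfolding frame by (rule \<sigma>(5)) (use that len in linarith)
    then have input: "\<rho> ''in'' ?i = fst (as ! j)" "\<rho> ''in'' (?i + 1) = snd (as ! j)"
      "\<rho> ''in'' (?i + 2) = cap (as ! j)"
      using nth_encoding(5-7)[OF j(1), of vs] by simp_all
    define \<mu> where "\<mu> = straight load_arc \<rho>"
    have \<mu>: "\<mu> ''u'' = (\<rho> ''u'')(j := fst (as ! j))" "\<mu> ''v'' = (\<rho> ''v'')(j := snd (as ! j))"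
      "\<mu> ''c'' = (\<rho> ''c'')(j := cap (as ! j))" "\<mu> ''p'' 0 = ?i + 3"
      using input p j(3) by (simp_all add: \<mu>_def load_arc_def)
    have \<mu>': "\<mu> A = \<rho> A" if "A \<notin> {''u'', ''v'', ''c'', ''p''}" for A
      using that by (simp add: \<mu>_def load_arc_def)
    define \<nu> where "\<nu> = straight c \<mu>"
    have \<nu>k: "\<nu> ''k'' = (\<mu> ''k'')(j := key (as ! j))"
      using key j(1,3) \<mu> \<mu>' frame \<sigma>(1,3) unfolding sets_key_def \<nu>_def by simp
    have \<nu>: "\<nu> A = \<mu> A" if "A \<noteq> ''k''" for A
    proof -
      have "runs c \<mu> (straight_time c) (\<lambda>\<tau>. \<tau> = \<nu>)"
        unfolding \<nu>_def by (intro runs_straight c) simp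
      from runs_frame[OF this] show ?thesis using that c(2) by (auto simp: runs_def)
    qed
    have "loaded (Suc j) (upd ''l'' 0 (Suc j) \<nu>)"
      using j(2) by (simp add: loaded_def \<nu> \<nu>k \<mu> \<mu>' All_less_Suc)
    then have "loaded (Suc j) (upd ''l'' 0 (Suc j) (straight ?c \<rho>))"
      by (simp only: \<nu>_def \<mu>_def straight.simps)
    moreover have "while_free ?c" by (simp add: c)
    ultimately show "runs ?c \<rho> (straight_time ?c) (\<lambda>\<tau>. loaded (Suc j) (upd ''l'' 0 (Suc j) \<tau>))"
      by (intro runs_straight)
  qed
  show ?thesis
  proof (rule runs_weaken[OF runs_frame[OF run] order_refl])
    fix \<tau> assume \<tau>: "loaded m \<tau> \<and> (\<forall>A. A \<notin> writes (For ''l'' ?c) \<longrightarrow> \<tau> A = \<sigma> A)"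
    then have "\<tau> ''m'' = \<sigma> ''m''" "\<tau> ''s'' = \<sigma> ''s''" "\<tau> ''t'' = \<sigma> ''t''"
      by (simp_all add: w del: writes.simps(3))
    then show "stored \<tau>" using \<tau> \<sigma> by (simp add: stored_def loaded_def)
  qed
qed

lemma runs_solve:
  assumes key: "sets_key c"
  shows "runs (solve c p) (initial_memory (encoding vs)) (solve_time c p m)
     (\<lambda>\<tau>. \<tau> ''outlen'' 0 = m \<and> solution p (\<tau> ''w'' 0) (\<tau> ''out'') \<and>
       (\<forall>k<p. \<forall>e<m. covered k e (\<tau> ''w'' 0)))"
  unfolding solve_def solve_time_def
proof (rule runs_Seq)
  let ?\<sigma> = "initial_memory (encoding vs)"
  let ?c = "Seq load_arc c"
  have w: "writes ?c = {''u'', ''v'', ''c'', ''p'', ''k''}"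
    using key by (auto simp: sets_key_def load_arc_def)
  define \<mu> where "\<mu> = straight load_header ?\<sigma>"
  show "runs load_header ?\<sigma> (straight_time load_header) (\<lambda>\<tau>. \<tau> = \<mu>)"
    unfolding \<mu>_def by (intro runs_straight while_free_simps) simp
  have inp: "?\<sigma> ''in'' i = encoding vs ! i" if "i < length (encoding vs)" for i
    using that by (simp add: initial_memory_def)
  have hd: "?\<sigma> ''in'' 0 = length vs" "?\<sigma> ''in'' 1 = m" "?\<sigma> ''in'' 2 = s" "?\<sigma> ''in'' 3 = t"
    using inp[of 0] inp[of 1] inp[of 2] inp[of 3] nth_encoding(1-4)[of vs]
    by (simp_all add: length_encoding)
  have \<mu>: "\<mu> ''m'' 0 = m" "\<mu> ''s'' 0 = s" "\<mu> ''t'' 0 = t" "\<mu> ''p'' 0 = 4 + length vs"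
    "\<mu> ''outlen'' 0 = m" "\<mu> ''in'' = ?\<sigma> ''in''"
    using hd by (simp_all add: \<mu>_def load_header_def)
  \<comment> \<open>Memory outside the input starts with zeros, so no key is blocked and the zero
    flow of value 0 is already in place.\<close>
  have zero: "\<mu> ''b'' = (\<lambda>_. 0)" "\<mu> ''w'' = (\<lambda>_. 0)" "\<mu> ''out'' = (\<lambda>_. 0)"
    by (simp_all add: \<mu>_def load_header_def initial_memory_def)
  fix \<tau> assume "\<tau> = \<mu>"
  have load: "runs (For ''l'' ?c) \<mu> (for_time m (straight_time ?c)) stored"
    by (rule runs_load[OF key, of \<mu> vs]) (simp_all add: \<mu> inp)
  show "runs (Seq (For ''l'' ?c) (optimize p)) \<tau>
     (for_time m (straight_time ?c) + optimize_time p m)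
     (\<lambda>\<tau>. \<tau> ''outlen'' 0 = m \<and> solution p (\<tau> ''w'' 0) (\<tau> ''out'') \<and>
       (\<forall>k<p. \<forall>e<m. covered k e (\<tau> ''w'' 0)))"
    unfolding \<open>\<tau> = \<mu>\<close>
  proof (rule runs_Seq[OF runs_frame[OF load]])
    fix \<rho> assume \<rho>: "stored \<rho> \<and> (\<forall>A. A \<notin> writes (For ''l'' ?c) \<longrightarrow> \<rho> A = \<mu> A)"
    then have same: "\<rho> ''b'' = \<mu> ''b''" "\<rho> ''w'' = \<mu> ''w''" "\<rho> ''out'' = \<mu> ''out''" "\<rho> ''outlen'' = \<mu> ''outlen''"
      by (simp_all add: w del: writes.simps(3))
    have st: "stored \<rho>" using \<rho> by blast
    have bl: "blocked \<rho> = {}" by (simp add: blocked_def same zero)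
    have wo: "\<rho> ''w'' 0 = 0" "\<rho> ''out'' j = 0" for j by (simp_all add: same zero)
    show "runs (optimize p) \<rho> (optimize_time p m)
     (\<lambda>\<tau>. \<tau> ''outlen'' 0 = m \<and> solution p (\<tau> ''w'' 0) (\<tau> ''out'') \<and>
       (\<forall>k<p. \<forall>e<m. covered k e (\<tau> ''w'' 0)))"
    proof (rule runs_weaken[OF runs_frame[OF runs_optimize[where \<sigma> = \<rho>, OF st bl wo]] order_refl])
      fix \<nu> assume \<nu>: "(blocked \<nu> = {} \<and> solution p (\<nu> ''w'' 0) (\<nu> ''out'') \<and>
        (\<forall>k<p. \<forall>e<m. covered k e (\<nu> ''w'' 0))) \<and> (\<forall>A. A \<notin> writes (optimize p) \<longrightarrow> \<nu> A = \<rho> A)"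
      then have "\<nu> ''outlen'' = \<rho> ''outlen''" by (simp add: not_writes_optimize)
      then show "\<nu> ''outlen'' 0 = m \<and> solution p (\<nu> ''w'' 0) (\<nu> ''out'') \<and>
        (\<forall>k<p. \<forall>e<m. covered k e (\<nu> ''w'' 0))"
        using \<nu> same \<mu>(5) by simp
    qed
  qed
qed

text \<open>The extra \<open>m\<close> pays for the output, which is charged one unit per
  number.\<close>

lemma solve_computes:
  assumes "sets_key c"
  shows "\<exists>T b x. computes_in_time (solve c p) (encoding vs) T (map x [0..<m]) \<and>
     T \<le> solve_time c p m + m \<and> solution p b x \<and> (\<forall>k<p. \<forall>e<m. covered k e b)"
proof -
  obtain T \<tau> where \<tau>: "exec (solve c p) (initial_memory (encoding vs)) T \<tau>" "T \<le> solve_time c p m"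
    "\<tau> ''outlen'' 0 = m" "solution p (\<tau> ''w'' 0) (\<tau> ''out'')"
    "\<forall>k<p. \<forall>e<m. covered k e (\<tau> ''w'' 0)"
    using runs_solve[OF assms, of p vs] unfolding runs_def by blast
  have "computes_in_time (solve c p) (encoding vs) (T + m) (map (\<tau> ''out'') [0..<m])"
    unfolding computes_in_time_def
    using \<tau>(1,3) by (intro exI[of _ T] exI[of _ \<tau>]) (simp add: output_of_def)
  then show ?thesis using \<tau>(2,4,5) by (intro exI[of _ "T + m"] exI) auto
qed

end

section \<open>Path-flows\<close>

lemma st_path_iff:
  assumes "flow_network N"
  shows "st_path N P \<longleftrightarrow> set P \<subseteq> parcs (graph_of N) \<and> pcas (src N) P (snk N) \<and>
    distinct (pawalk_verts (src N) P)"
  using assms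
  by (auto simp: st_path_def pre_digraph.apath_def pre_digraph.awalk_def flow_network_def
      cas_with_proj_eq awalk_verts_with_proj_eq)

lemma pcas_append: "pcas u (P @ Q) w \<longleftrightarrow> (\<exists>v. pcas u P v \<and> pcas v Q w)"
  by (induction P arbitrary: u) auto

lemma pcas_rtrancl: "pcas u P v \<Longrightarrow> set P \<subseteq> R \<Longrightarrow> (u, v) \<in> R\<^sup>*"
  by (induction P arbitrary: u) (auto intro: converse_rtrancl_into_rtrancl)

lemma pcas_successively: "pcas u P v \<Longrightarrow> successively (\<lambda>a b. snd a = fst b) P"
proof (induction P arbitrary: u)
  case (Cons a P)
  then show ?case by (cases P) auto
qed simp

lemma pcas_ends: "pcas u P v \<Longrightarrow> P \<noteq> [] \<Longrightarrow> fst (hd P) = u \<and> snd (last P) = v"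
proof (induction P arbitrary: u)
  case (Cons a P)
  then show ?case by (cases P) auto
qed simp

text \<open>Because \<open>tl\<close> omits the start of the walk, this shows that a path has no arc
  back into its start.\<close>

lemma snd_in_pawalk_verts: "a \<in> set P \<Longrightarrow> pcas u P v \<Longrightarrow> snd a \<in> set (tl (pawalk_verts u P))"
proof (induction P arbitrary: u)
  case (Cons b P)
  then show ?case by (cases P) auto
qed simp

lemma set_pawalk_verts: "pcas u P v \<Longrightarrow> set (pawalk_verts u P) = insert u (snd ` set P)"
proof (induction P arbitrary: u)
  case (Cons a P)
  then show ?case by auto
qed simp

lemma fst_in_pawalk_verts: "a \<in> set P \<Longrightarrow> fst a \<in> set (pawalk_verts u P)"
  by (induction P arbitrary: u) auto

lemma distinct_of_pawalk_verts: "pcas u P v \<Longrightarrow> distinct (pawalk_verts u P) \<Longrightarrow> distinct P"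
proof (induction P arbitrary: u)
  case (Cons a P)
  then have "u \<notin> set (pawalk_verts (snd a) P)" "distinct P" "fst a = u" by auto
  then show ?case using fst_in_pawalk_verts[of a P "snd a"] by auto
qed simp

text \<open>Reachability gives a walk, and shortening it to a path by \<open>awalk_to_apath\<close>
  uses no new arcs.\<close>

lemma st_path_of_rtrancl:
  assumes net: "flow_network N" and R: "R \<subseteq> parcs (graph_of N)" and st: "(src N, snk N) \<in> R\<^sup>*"
  shows "\<exists>P. st_path N P \<and> set P \<subseteq> R"
proof -
  interpret pair_digraph "graph_of N" using net by (simp add: flow_network_def)
  have "\<exists>P. pcas (src N) P (snk N) \<and> set P \<subseteq> R" using st
  proof (induction rule: rtrancl_induct)
    case base
    show ?case by (rule exI[of _ "[]"]) simp
  next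
    case (step v w)
    then obtain P where "pcas (src N) P v" "set P \<subseteq> R" by blast
    moreover have "pcas v [(v, w)] w" by simp
    ultimately have "pcas (src N) (P @ [(v, w)]) w" unfolding pcas_append by blast
    moreover have "set (P @ [(v, w)]) \<subseteq> R" using \<open>set P \<subseteq> R\<close> step.hyps(2) by simp
    ultimately show ?case by blast
  qed
  then obtain P where P: "pcas (src N) P (snk N)" "set P \<subseteq> R" by blast
  then have aw: "awalk (src N) P (snk N)"
    using net R by (auto simp: awalk_def flow_network_def)
  have "st_path N (awalk_to_apath P)"
    unfolding st_path_def using apath_awalk_to_apath[OF aw] by simp
  then show ?thesis using awalk_to_apath_subset[OF aw] P(2) by blast
qed

text \<open>Every visit to \<open>w\<close> pairs an entering with a leaving arc, except at the two
  ends. This one identity gives both the conservation and the value of a path-flow.\<close>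

lemma pcas_balance:
  assumes "pcas u P v" "distinct P"
  shows "card {a \<in> set P. snd a = w} + (if w = u then 1 else 0) =
    card {a \<in> set P. fst a = w} + (if w = v then 1 else 0)"
  using assms
proof (induction P arbitrary: u)
  case (Cons a P)
  have "card {b \<in> set (a # P). f b = w} = card {b \<in> set P. f b = w} + (if f a = w then 1 else 0)"
    for f :: "'a \<times> 'a \<Rightarrow> 'a"
  proof -
    have "{b \<in> set (a # P). f b = w} =
      (if f a = w then insert a {b \<in> set P. f b = w} else {b \<in> set P. f b = w})" by auto
    then show ?thesis using Cons.prems(2) by simp
  qed
  then show ?case using Cons.IH[of "snd a"] Cons.prems by auto
qed simp

abbreviation flow_along :: "'a list \<Rightarrow> nat \<Rightarrow> 'a \<Rightarrow> nat" where
  "flow_along P r \<equiv> \<lambda>a. if a \<in> set P then r else 0"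

context
  fixes N :: "'a flow_network"
  assumes net: "flow_network N"
begin

lemma finite_arcs: "finite (parcs (graph_of N))"
proof -
  interpret pair_digraph "graph_of N" using net by (simp add: flow_network_def)
  show ?thesis by (rule pair_finite_arcs)
qed

lemma in_arcs_eq: "in_arcs (graph_of N) v = {a \<in> parcs (graph_of N). snd a = v}"
  and out_arcs_eq: "out_arcs (graph_of N) v = {a \<in> parcs (graph_of N). fst a = v}"
  by (auto simp: in_arcs_def out_arcs_def)

lemma sum_flow_along:
  assumes "set P \<subseteq> parcs (graph_of N)"
  shows "(\<Sum>a \<in> {a \<in> parcs (graph_of N). f a = v}. flow_along P r a) = r * card {a \<in> set P. f a = v}"
proof -
  have "(\<Sum>a \<in> {a \<in> parcs (graph_of N). f a = v}. flow_along P r a) =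
    (\<Sum>a \<in> {a \<in> set P. f a = v}. r)"
    using assms finite_arcs by (intro sum.mono_neutral_cong_right) auto
  then show ?thesis by simp
qed

lemma st_path_balance:
  assumes "st_path N P"
  shows "card {a \<in> set P. snd a = w} + (if w = src N then 1 else 0) =
    card {a \<in> set P. fst a = w} + (if w = snk N then 1 else 0)"
  using assms distinct_of_pawalk_verts unfolding st_path_iff[OF net] by (intro pcas_balance) auto

lemma path_flow_along:
  assumes P: "st_path N P" and cap: "\<And>a. a \<in> set P \<Longrightarrow> r \<le> capacity N a"
  shows "path_flow N P (flow_along P r)"
  unfolding path_flow_def st_flow_def
proof (intro conjI ballI)
  have sub: "set P \<subseteq> parcs (graph_of N)" using P by (simp add: st_path_iff[OF net])
  show "st_path N P" by (rule P)
  show "flow_along P r a \<le> capacity N a" for a using cap by simp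
  show "(\<Sum>a \<in> in_arcs (graph_of N) v. flow_along P r a) =
      (\<Sum>a \<in> out_arcs (graph_of N) v. flow_along P r a)"
    if "v \<in> pverts (graph_of N) - {src N, snk N}" for v
    using st_path_balance[OF P, of v] that
    unfolding in_arcs_eq out_arcs_eq sum_flow_along[OF sub] by simp
qed blast

lemma flow_value_along:
  assumes "st_path N P"
  shows "flow_value N (flow_along P r) = int r"
proof -
  have sub: "set P \<subseteq> parcs (graph_of N)" using assms by (simp add: st_path_iff[OF net])
  have "src N \<noteq> snk N" using net by (simp add: flow_network_def)
  then have "card {a \<in> set P. fst a = src N} = card {a \<in> set P. snd a = src N} + 1"
    using st_path_balance[OF assms, of "src N"] by simp
  then show ?thesis
    unfolding flow_value_def in_arcs_eq out_arcs_eq sum_flow_along[OF sub]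
    by (simp add: distrib_left)
qed

lemma flow_value_sum: "flow_value N (\<lambda>a. \<Sum>P \<in> \<P>. f P a) = (\<Sum>P \<in> \<P>. flow_value N (f P))"
  unfolding flow_value_def
  by (simp add: sum_subtractf sum.swap[of _ \<P>])

lemma st_path_not_Nil: "st_path N P \<Longrightarrow> P \<noteq> []"
  using net by (auto simp: st_path_iff flow_network_def)

lemma st_path_snd_neq_src:
  assumes "st_path N P" "a \<in> set P"
  shows "snd a \<noteq> src N"
proof -
  have P: "pcas (src N) P (snk N)" "distinct (pawalk_verts (src N) P)"
    using assms(1) by (auto simp: st_path_iff[OF net])
  have "snd a \<in> set (tl (pawalk_verts (src N) P))" by (rule snd_in_pawalk_verts[OF assms(2) P(1)])
  moreover have "pawalk_verts (src N) P = src N # tl (pawalk_verts (src N) P)"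
    using P(1) by (cases P) auto
  ultimately show ?thesis using P(2) by (metis distinct.simps(2))
qed

end

text \<open>Ordering the weights decreasingly, the \<open>i\<close>-th one is at most \<open>b / i\<close>; the induction removes the
  smallest weight.\<close>

lemma sum_le_harm:
  fixes r :: "'b \<Rightarrow> nat"
  assumes "finite \<P>" and "\<And>\<Q>. \<Q> \<subseteq> \<P> \<Longrightarrow> \<Q> \<noteq> {} \<Longrightarrow> card \<Q> * Min (r ` \<Q>) \<le> b"
  shows "real (\<Sum>P \<in> \<P>. r P) \<le> real b * harm (card \<P>)"
  using assms
proof (induction "card \<P>" arbitrary: \<P>)
  case 0
  then show ?case by (simp add: harm_expand)
next
  case (Suc n)
  then have ne: "\<P> \<noteq> {}" by auto
  have "Min (r ` \<P>) \<in> r ` \<P>" using ne Suc.prems(1) by (intro Min_in) auto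
  then obtain P where P: "Min (r ` \<P>) = r P" "P \<in> \<P>" by (rule imageE)
  have "real (\<Sum>Q \<in> \<P> - {P}. r Q) \<le> real b * harm (card (\<P> - {P}))"
  proof (rule Suc.hyps(1))
    show "n = card (\<P> - {P})" using Suc.hyps(2) P(2) Suc.prems(1) by simp
    show "finite (\<P> - {P})" using Suc.prems(1) by simp
    show "card \<Q> * Min (r ` \<Q>) \<le> b" if "\<Q> \<subseteq> \<P> - {P}" "\<Q> \<noteq> {}" for \<Q>
      using that by (intro Suc.prems(2)) auto
  qed
  moreover have "card (\<P> - {P}) = n" using Suc.hyps(2) P(2) Suc.prems(1) by simp
  moreover have "real (\<Sum>Q \<in> \<P>. r Q) = real (r P) + real (\<Sum>Q \<in> \<P> - {P}. r Q)"
    using Suc.prems(1) P(2) by (simp add: sum.remove)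
  moreover have "real (r P) \<le> real b * inverse (real (Suc n))"
  proof -
    have "Suc n * r P \<le> b" using Suc.prems(2)[of \<P>] ne P(1) Suc.hyps(2) by simp
    then have "real (Suc n) * real (r P) \<le> real b" by (metis of_nat_le_iff of_nat_mult)
    then show ?thesis by (simp add: field_simps)
  qed
  ultimately show ?case using Suc.hyps(2)[symmetric] by (simp only: harm_Suc distrib_left)
qed

section \<open>Networks with keyed arcs\<close>

text \<open>\<open>sep_iff\<close> compares distinct paths only: a path consisting of a single arc
  from source to sink is internally disjoint from itself, but shares its key with itself.\<close>

locale keyed_network = arc_table as key "capacity N" "src N" "snk N"
  for as key and N :: "nat flow_network" +
  fixes sep :: "nat flow_network \<Rightarrow> (nat \<times> nat) list \<Rightarrow> (nat \<times> nat) list \<Rightarrow> bool"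
  assumes net: "flow_network N" and arcs: "set as = parcs (graph_of N)"
    and key_head: "a \<in> set as \<Longrightarrow> b \<in> set as \<Longrightarrow> key a = key b \<Longrightarrow> snd a = snd b"
    and sep_iff: "st_path N P \<Longrightarrow> st_path N Q \<Longrightarrow> P \<noteq> Q \<Longrightarrow>
      sep N P Q \<longleftrightarrow> key ` set P \<inter> key ` set Q = {}"
begin

lemma st_path_subset: "st_path N P \<Longrightarrow> set P \<subseteq> set as"
  by (simp add: st_path_iff[OF net] arcs)

lemma linked_antimono: "linked S K \<Longrightarrow> K' \<subseteq> K \<Longrightarrow> linked S K'"
  unfolding linked_def by (rule rtrancl_mono[THEN subsetD]) auto

lemma linked_path:
  assumes "linked S K" "S \<subseteq> set as"
  shows "\<exists>P. st_path N P \<and> set P \<subseteq> S \<and> key ` set P \<inter> K = {}"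
proof -
  let ?R = "{a \<in> S. key a \<notin> K}"
  have "\<exists>P. st_path N P \<and> set P \<subseteq> ?R"
    using assms by (intro st_path_of_rtrancl[OF net]) (auto simp: linked_def arcs)
  then show ?thesis by blast
qed

lemma path_linked:
  assumes "st_path N P" "set P \<subseteq> S" "key ` set P \<inter> K = {}"
  shows "linked S K"
  unfolding linked_def
  by (rule pcas_rtrancl[of _ P]) (use assms in \<open>auto simp: st_path_iff[OF net]\<close>)

text \<open>A set with fewer than \<open>k\<close> keys is padded with the keys of arbitrary arcs,
  for which some arc must exist; connectivity after removing more keys implies it for fewer.\<close>

lemma robust_linked:
  assumes "robust k S K" "as \<noteq> []" "finite X" "X \<subseteq> key ` set as" "card X \<le> k"
  shows "linked S (K \<union> X)"
  using assms
proof (induction k arbitrary: K X)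
  case 0
  then show ?case by simp
next
  case (Suc k)
  obtain a where a: "a \<in> set as" "X \<noteq> {} \<Longrightarrow> key a \<in> X"
  proof (cases "X = {}")
    case True
    then show ?thesis using that Suc.prems(2) by (metis list.set_intros(1) neq_Nil_conv)
  next
    case False
    then show ?thesis using that Suc.prems(4) by blast
  qed
  have "linked S (insert (key a) K \<union> (X - {key a}))"
  proof (rule Suc.IH)
    show "robust k S (insert (key a) K)" using Suc.prems(1) a(1) by simp
    show "card (X - {key a}) \<le> k"
      using Suc.prems(3,5) a(2) by (cases "X = {}") (simp_all add: card_Diff_singleton)
  qed (use Suc.prems in auto)
  then show ?case by (rule linked_antimono) auto
qed

lemma linked_robust:
  assumes "\<And>X. finite X \<Longrightarrow> card X \<le> k \<Longrightarrow> linked S (K \<union> X)"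
  shows "robust k S K"
  using assms
proof (induction k arbitrary: K)
  case 0
  show ?case using 0[of "{}"] by simp
next
  case (Suc k)
  have "robust k S (insert (key a) K)" for a
  proof (rule Suc.IH)
    fix X :: "nat set" assume X: "finite X" "card X \<le> k"
    then have "linked S (K \<union> insert (key a) X)"
      by (intro Suc.prems) (simp_all add: card_insert_if)
    then show "linked S (insert (key a) K \<union> X)" by simp
  qed
  then show ?case by simp
qed

section \<open>Key-disjoint paths and cuts\<close>

definition key_disjoint :: "(nat \<times> nat) list set \<Rightarrow> bool" where
  "key_disjoint \<P> \<longleftrightarrow> (\<forall>P \<in> \<P>. st_path N P) \<and>
     pairwise (\<lambda>P Q. key ` set P \<inter> key ` set Q = {}) \<P>"

text \<open>Each removed key lies on at most one of the paths, so \<open>k\<close> removed keys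
  leave one of more than \<open>k\<close> paths intact.\<close>

lemma robust_of_paths:
  assumes "key_disjoint \<P>" "finite \<P>" "k < card \<P>" "\<And>P. P \<in> \<P> \<Longrightarrow> set P \<subseteq> S"
  shows "robust k S {}"
proof (rule linked_robust)
  fix X :: "nat set" assume X: "finite X" "card X \<le> k"
  have "\<exists>P \<in> \<P>. key ` set P \<inter> X = {}"
  proof (rule ccontr)
    assume "\<not> ?thesis"
    then have "\<forall>P \<in> \<P>. \<exists>\<kappa>. \<kappa> \<in> key ` set P \<and> \<kappa> \<in> X" by blast
    then obtain g where g: "\<forall>P \<in> \<P>. g P \<in> key ` set P \<and> g P \<in> X" by (rule bchoice[THEN exE])
    have "inj_on g \<P>"
    proof (rule inj_onI, rule ccontr)
      fix P Q assume PQ: "P \<in> \<P>" "Q \<in> \<P>" "g P = g Q" "P \<noteq> Q"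
      then have "key ` set P \<inter> key ` set Q = {}"
        using assms(1) by (auto simp: key_disjoint_def pairwise_def)
      moreover have "g P \<in> key ` set P" "g P \<in> key ` set Q" using g PQ by metis+
      ultimately show False by blast
    qed
    then have "card \<P> \<le> card X" by (rule card_inj_on_le) (use g X in auto)
    then show False using X assms(3) by simp
  qed
  then obtain P where "P \<in> \<P>" "key ` set P \<inter> X = {}" by blast
  then show "linked S ({} \<union> X)"
    using assms(1,4) by (intro path_linked[of P]) (auto simp: key_disjoint_def)
qed

text \<open>The line digraph of \<open>S\<close> with arcs of equal key identified, so that its
  vertex-disjoint walks use disjoint sets of keys.\<close>

definition key_graph :: "(nat \<times> nat) set \<Rightarrow> (nat \<times> nat) set" where
  "key_graph S = {(key a, key b) | a b. a \<in> S \<and> b \<in> S \<and> snd a = fst b}"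

definition out_keys :: "(nat \<times> nat) set \<Rightarrow> nat set" where
  "out_keys S = key ` {a \<in> S. fst a = src N}"

definition in_keys :: "(nat \<times> nat) set \<Rightarrow> nat set" where
  "in_keys S = key ` {a \<in> S. snd a = snk N}"

lemma path_between_keys:
  assumes "st_path N P" "set P \<subseteq> S"
  shows "path_between (key_graph S) (out_keys S) (in_keys S) (map key P)"
proof -
  have P: "pcas (src N) P (snk N)" "P \<noteq> []"
    using assms(1) st_path_not_Nil[OF net] by (auto simp: st_path_iff[OF net])
  have "fst (hd P) = src N" "snd (last P) = snk N" using pcas_ends[OF P] by auto
  moreover have "hd P \<in> S" "last P \<in> S" using P(2) assms(2) by auto
  moreover have "successively (\<lambda>a b. (key a, key b) \<in> key_graph S) P"
    by (rule successively_mono[OF pcas_successively[OF P(1)]])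
       (use assms(2) in \<open>unfold key_graph_def, blast\<close>)
  ultimately show ?thesis
    using P(2) by (auto simp: path_between_def out_keys_def in_keys_def hd_map last_map successively_map)
qed

text \<open>The arc \<open>c\<close> witnessing the next step may differ from the arc
  \<open>a\<close> by which the current key was reached. Both have the same head by
  \<open>key_head\<close>, so the walk in the network goes on from there although the tails may
  differ.\<close>

lemma key_walk_reaches:
  assumes "successively (\<lambda>\<kappa> \<kappa>'. (\<kappa>, \<kappa>') \<in> key_graph S) p" "p \<noteq> []" "S \<subseteq> set as"
    and "a \<in> S" "key a = hd p" "(u, snd a) \<in> R\<^sup>*" "{b \<in> S. key b \<in> set p} \<subseteq> R"
  shows "\<exists>b \<in> S. key b = last p \<and> (u, snd b) \<in> R\<^sup>*"
  using assms
proof (induction p arbitrary: a rule: induct_list012)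
  case (3 \<kappa> \<kappa>' p)
  have "(\<kappa>, \<kappa>') \<in> key_graph S" using 3(3) by simp
  then obtain c d where cd: "c \<in> S" "d \<in> S" "snd c = fst d" "key c = \<kappa>" "key d = \<kappa>'"
    unfolding key_graph_def by blast
  have "key a = key c" using 3(7) cd(4) by simp
  then have "snd a = snd c" using 3(5,6) cd(1) by (intro key_head) auto
  then have fd: "(u, fst d) \<in> R\<^sup>*" using 3(8) cd(3) by simp
  have "d \<in> R" using 3(9) cd(2,5) by auto
  then have "(fst d, snd d) \<in> R" by simp
  with fd have d: "(u, snd d) \<in> R\<^sup>*" by (rule rtrancl_into_rtrancl)
  have "\<exists>b \<in> S. key b = last (\<kappa>' # p) \<and> (u, snd b) \<in> R\<^sup>*"
  proof (rule 3(2))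
    show "successively (\<lambda>\<kappa> \<kappa>'. (\<kappa>, \<kappa>') \<in> key_graph S) (\<kappa>' # p)" using 3(3) by simp
    show "{b \<in> S. key b \<in> set (\<kappa>' # p)} \<subseteq> R" using 3(9) by auto
  qed (use 3(5) cd d in simp_all)
  then show ?case by simp
qed auto

lemma path_of_keys:
  assumes p: "path_between (key_graph S) (out_keys S) (in_keys S) p" and S: "S \<subseteq> set as"
  shows "\<exists>P. st_path N P \<and> set P \<subseteq> S \<and> key ` set P \<subseteq> set p"
proof -
  \<comment> \<open>All arcs with a key on the walk. A path found inside this set uses only keys of
    \<open>p\<close>, so disjoint walks of keys give disjoint paths.\<close>
  let ?R = "{b \<in> S. key b \<in> set p}"
  obtain a where a: "a \<in> S" "fst a = src N" "key a = hd p"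
    using p by (auto simp: path_between_def out_keys_def)
  obtain c where c: "c \<in> S" "snd c = snk N" "key c = last p"
    using p by (auto simp: path_between_def in_keys_def)
  have "a \<in> ?R" using a p by (simp add: path_between_def)
  then have "(src N, snd a) \<in> ?R" unfolding a(2)[symmetric] prod.collapse .
  then have "(src N, snd a) \<in> ?R\<^sup>*" by (rule r_into_rtrancl)
  then have "\<exists>b \<in> S. key b = last p \<and> (src N, snd b) \<in> ?R\<^sup>*"
    using p a S by (intro key_walk_reaches) (auto simp: path_between_def)
  then obtain b where b: "b \<in> S" "key b = last p" "(src N, snd b) \<in> ?R\<^sup>*" by blast
  \<comment> \<open>The arc \<open>b\<close> at which the lifted walk arrives need not be the arc
    \<open>c\<close> into the sink, but it has the same key and hence the same head.\<close>
  have "snd b = snd c" using b c S by (intro key_head) auto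
  then have "(src N, snk N) \<in> ?R\<^sup>*" using b(3) c(2) by simp
  then have "\<exists>P. st_path N P \<and> set P \<subseteq> ?R"
    using S by (intro st_path_of_rtrancl[OF net]) (auto simp: arcs)
  then show ?thesis by blast
qed

text \<open>Removing a separator with at most \<open>k\<close> keys would leave a path by
  robustness, and the keys of this path form a walk that the separator misses. So Menger's theorem
  gives \<open>Suc k\<close> disjoint walks of keys, each of which is lifted to a path.\<close>

lemma paths_of_robust:
  assumes rob: "robust k S {}" and S: "S \<subseteq> set as" and ne: "as \<noteq> []"
  shows "\<exists>\<P>. finite \<P> \<and> card \<P> = Suc k \<and> key_disjoint \<P> \<and> (\<forall>P \<in> \<P>. set P \<subseteq> S)"
proof -
  have finS: "finite S" using S finite_subset by blast
  have "key_graph S \<subseteq> key ` S \<times> key ` S" by (auto simp: key_graph_def)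
  then have fin: "finite (key_graph S)" using finS finite_subset by blast
  have "finite (out_keys S)" using finS by (simp add: out_keys_def)
  moreover have "Suc k \<le> card X"
    if X: "finite X" "separates (key_graph S) (out_keys S) (in_keys S) X" for X
  proof (rule ccontr)
    \<comment> \<open>A separator may contain numbers that are not keys of arcs; no path meets
      these, and \<open>robust\<close> does not speak about them.\<close>
    let ?X = "X \<inter> key ` set as"
    assume "\<not> Suc k \<le> card X"
    moreover have "card ?X \<le> card X" using X(1) by (intro card_mono) auto
    ultimately have "card ?X \<le> k" by simp
    then have "linked S ({} \<union> ?X)" using X(1) by (intro robust_linked[OF rob ne]) auto
    then obtain P where P: "st_path N P" "set P \<subseteq> S" "key ` set P \<inter> ?X = {}"
      using linked_path[of S ?X] S by auto
    have "set (map key P) \<inter> X \<noteq> {}"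
      using X(2) path_between_keys[OF P(1,2)] unfolding separates_def by blast
    then show False using P S by auto
  qed
  ultimately obtain \<Q> where Q: "finite \<Q>" "card \<Q> = Suc k"
    "path_system (key_graph S) (out_keys S) (in_keys S) \<Q>"
    using menger[OF fin, of "out_keys S" "in_keys S" "Suc k"] by blast
  have "\<forall>p \<in> \<Q>. \<exists>P. st_path N P \<and> set P \<subseteq> S \<and> key ` set P \<subseteq> set p"
    using Q(3) path_of_keys[OF _ S] by (simp add: path_system_def)
  then obtain g where g: "\<forall>p \<in> \<Q>. st_path N (g p) \<and> set (g p) \<subseteq> S \<and> key ` set (g p) \<subseteq> set p"
    by (rule bchoice[THEN exE])
  have disj: "key ` set (g p) \<inter> key ` set (g q) = {}" if "p \<in> \<Q>" "q \<in> \<Q>" "p \<noteq> q" for p q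
  proof -
    have "set p \<inter> set q = {}" using Q(3) that by (simp add: path_system_def pairwise_def)
    then show ?thesis using g that by blast
  qed
  \<comment> \<open>Paths from source to sink are nonempty, so a path with disjoint keys from
    another one differs from it; thus none of the \<open>Suc k\<close> paths is lost.\<close>
  have "inj_on g \<Q>"
  proof (rule inj_onI, rule ccontr)
    fix p q assume pq: "p \<in> \<Q>" "q \<in> \<Q>" "g p = g q" "p \<noteq> q"
    have "g p \<noteq> []" using g pq(1) st_path_not_Nil[OF net] by blast
    then show False using disj[OF pq(1,2,4)] pq(3) by simp
  qed
  then have "card (g ` \<Q>) = Suc k" using Q(2) by (simp add: card_image)
  moreover have "key_disjoint (g ` \<Q>)"
    unfolding key_disjoint_def pairwise_def using g disj by blast
  ultimately show ?thesis using g Q(1) by (intro exI[of _ "g ` \<Q>"]) auto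
qed

text \<open>By minimality, the arcs outside \<open>k + 1\<close> disjoint paths would have been dropped.\<close>

lemma paths_of_minimal_robust:
  assumes min: "minimal_robust k S" and S: "S \<subseteq> set as" and ne: "as \<noteq> []"
  shows "\<exists>\<P>. finite \<P> \<and> card \<P> = Suc k \<and> key_disjoint \<P> \<and> (\<Union>P \<in> \<P>. set P) = S"
proof -
  have "robust k S {}" using min by (simp add: minimal_robust_def)
  then obtain \<P> where P: "finite \<P>" "card \<P> = Suc k" "key_disjoint \<P>" "\<forall>P \<in> \<P>. set P \<subseteq> S"
    using paths_of_robust[OF _ S ne] by blast
  have "a \<in> (\<Union>P \<in> \<P>. set P)" if "a \<in> S" for a
  proof (rule ccontr)
    assume a: "a \<notin> (\<Union>P \<in> \<P>. set P)"
    have "robust k (S - {a}) {}"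
      by (rule robust_of_paths[OF P(3,1)]) (use P a in auto)
    then show False using min that by (simp add: minimal_robust_def)
  qed
  then show ?thesis using P by (intro exI[of _ \<P>]) auto
qed

lemma solution_feasible:
  assumes sol: "solution p b x"
  shows "\<exists>y. map y as = map x [0..<m] \<and> sum_of_path_flows sep p N y \<and> flow_value N y = int b"
proof (cases "b = 0 \<and> (\<forall>j<m. x j = 0)")
  case True
  have "map (\<lambda>_. 0) as = map x [0..<m]" using True by (intro nth_equalityI) auto
  \<comment> \<open>The zero flow is the sum over the empty family of paths.\<close>
  moreover have "sum_of_path_flows sep p N (\<lambda>_. 0)"
    unfolding sum_of_path_flows_def by (auto simp: st_flow_def intro!: exI[of _ "{}"])
  moreover have "flow_value N (\<lambda>_. 0) = int b" using True by (simp add: flow_value_def)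
  ultimately show ?thesis by blast
next
  case False
  then obtain k r S where kr: "as \<noteq> []" "k < p" "S \<subseteq> wide r" "minimal_robust k S" "b = Suc k * r"
    "\<forall>j<m. x j = (if as ! j \<in> S then r else 0)"
    using sol unfolding solution_def by blast
  have S: "S \<subseteq> set as" using kr(3) by (auto simp: wide_def)
  obtain \<P> where P: "finite \<P>" "card \<P> = Suc k" "key_disjoint \<P>" "(\<Union>P \<in> \<P>. set P) = S"
    using paths_of_minimal_robust[OF kr(4) S kr(1)] by blast
  have st: "st_path N Q" if "Q \<in> \<P>" for Q using that P(3) by (simp add: key_disjoint_def)
  let ?y = "\<lambda>a. \<Sum>P \<in> \<P>. flow_along P r a"
  \<comment> \<open>Disjoint keys imply disjoint arcs, so each arc of \<open>S\<close> lies on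
    exactly one of the paths and carries exactly \<open>r\<close>.\<close>
  have y: "?y a = (if a \<in> S then r else 0)" for a
  proof (cases "a \<in> S")
    case True
    then obtain Q where Q: "Q \<in> \<P>" "a \<in> set Q" using P(4) by blast
    have "a \<notin> set Q'" if "Q' \<in> \<P> - {Q}" for Q'
    proof
      assume "a \<in> set Q'"
      moreover have "key ` set Q \<inter> key ` set Q' = {}"
        using that Q(1) P(3) unfolding key_disjoint_def pairwise_def by blast
      ultimately show False using Q(2) by blast
    qed
    then have "(\<Sum>P \<in> \<P> - {Q}. flow_along P r a) = 0" by (intro sum.neutral) auto
    then show ?thesis using True Q P(1) by (simp add: sum.remove[of \<P> Q])
  next
    case False
    then show ?thesis using P(4) by (auto intro: sum.neutral)
  qed
  have flow: "path_flow N Q (flow_along Q r)" if "Q \<in> \<P>" for Q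
  proof (rule path_flow_along[OF net st[OF that]])
    fix a assume "a \<in> set Q"
    then show "r \<le> capacity N a" using that P(4) kr(3) by (auto simp: wide_def)
  qed
  have "st_flow N ?y"
    unfolding st_flow_def
  proof (intro conjI ballI)
    fix a
    show "?y a \<le> capacity N a" unfolding y using kr(3) by (auto simp: wide_def)
  next
    fix v assume v: "v \<in> pverts (graph_of N) - {src N, snk N}"
    have "(\<Sum>a \<in> in_arcs (graph_of N) v. ?y a) =
      (\<Sum>Q \<in> \<P>. \<Sum>a \<in> in_arcs (graph_of N) v. flow_along Q r a)" by (rule sum.swap)
    also have "\<dots> = (\<Sum>Q \<in> \<P>. \<Sum>a \<in> out_arcs (graph_of N) v. flow_along Q r a)"
    proof (rule sum.cong[OF refl])
      fix Q assume "Q \<in> \<P>"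
      then show "(\<Sum>a \<in> in_arcs (graph_of N) v. flow_along Q r a) =
        (\<Sum>a \<in> out_arcs (graph_of N) v. flow_along Q r a)"
        using flow v unfolding path_flow_def st_flow_def by blast
    qed
    also have "\<dots> = (\<Sum>a \<in> out_arcs (graph_of N) v. ?y a)" by (rule sum.swap)
    finally show "(\<Sum>a \<in> in_arcs (graph_of N) v. ?y a) = (\<Sum>a \<in> out_arcs (graph_of N) v. ?y a)" .
  qed
  moreover have "pairwise (sep N) \<P>"
    using P(3) st sep_iff by (auto simp: key_disjoint_def pairwise_def)
  moreover have "card \<P> \<le> p" using P(2) kr(2) by simp
  ultimately have "sum_of_path_flows sep p N ?y"
    unfolding sum_of_path_flows_def using P(1) flow
    by (intro conjI exI[of _ \<P>] exI[of _ "\<lambda>P. flow_along P r"]) auto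
  moreover have "flow_value N ?y = int b"
  proof -
    have "flow_value N ?y = (\<Sum>P \<in> \<P>. flow_value N (flow_along P r))"
      by (rule flow_value_sum[OF net])
    also have "\<dots> = (\<Sum>P \<in> \<P>. int r)"
      by (rule sum.cong[OF refl]) (rule flow_value_along[OF net st])
    also have "\<dots> = int b" unfolding kr(5) sum_constant P(2) by (simp only: of_nat_mult)
    finally show ?thesis .
  qed
  moreover have "map ?y as = map x [0..<m]"
    unfolding y using kr(6) by (intro nth_equalityI) auto
  ultimately show ?thesis by (intro exI[of _ ?y] conjI)
qed

text \<open>Take any subfamily of the paths of a flow and an arc \<open>a\<close> of least capacity
  on them. Sending \<open>capacity N a\<close> along all of these paths is one of the covered
  trials, and no path through \<open>a\<close> carries more than that. This is the hypothesis of
  \<open>sum_le_harm\<close>.\<close>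

lemma max_flow_value_le:
  assumes cov: "\<forall>k<p. \<forall>j<m. covered k j b"
  shows "real_of_int (max_flow_value (sum_of_path_flows sep p) N) \<le> real b * harm p"
proof -
  have bound: "real_of_int (flow_value N x) \<le> real b * harm p"
    if x: "sum_of_path_flows sep p N x" for x
  proof -
    obtain \<P> f where P: "finite \<P>" "card \<P> \<le> p" "pairwise (sep N) \<P>"
      "\<forall>P \<in> \<P>. path_flow N P (f P)" "x = (\<lambda>a. \<Sum>P \<in> \<P>. f P a)"
      using x unfolding sum_of_path_flows_def by blast
    have "\<forall>P \<in> \<P>. \<exists>r. f P = flow_along P r"
      using P(4) unfolding path_flow_def by (simp add: fun_eq_iff)
    then obtain r where r: "\<forall>P \<in> \<P>. f P = flow_along P (r P)" by (rule bchoice[THEN exE])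
    have st: "st_path N P" if "P \<in> \<P>" for P using P(4) that by (simp add: path_flow_def)
    have cap: "r P \<le> capacity N a" if "P \<in> \<P>" "a \<in> set P" for P a
    proof -
      have "st_flow N (f P)" using P(4) that(1) by (simp add: path_flow_def)
      moreover have "a \<in> parcs (graph_of N)" using st_path_subset[OF st[OF that(1)]] that(2) arcs by blast
      ultimately have "f P a \<le> capacity N a" by (simp add: st_flow_def)
      then show ?thesis using r that by simp
    qed
    have "flow_value N x = (\<Sum>P \<in> \<P>. flow_value N (f P))"
      unfolding P(5) by (rule flow_value_sum[OF net])
    also have "\<dots> = (\<Sum>P \<in> \<P>. int (r P))"
    proof (rule sum.cong[OF refl])
      fix P assume "P \<in> \<P>"
      then show "flow_value N (f P) = int (r P)"
        using r flow_value_along[OF net st, of P "r P"] by simp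
    qed
    finally have val: "real_of_int (flow_value N x) = real (\<Sum>P \<in> \<P>. r P)" by simp
    have top: "card \<Q> * Min (r ` \<Q>) \<le> b" if Q: "\<Q> \<subseteq> \<P>" "\<Q> \<noteq> {}" for \<Q>
    proof -
      have finQ: "finite \<Q>" using Q(1) P(1) finite_subset by blast
      let ?U = "\<Union>P \<in> \<Q>. set P"
      have "finite ?U" using finQ by simp
      moreover have "?U \<noteq> {}" using Q st st_path_not_Nil[OF net] by fastforce
      ultimately have "Min (capacity N ` ?U) \<in> capacity N ` ?U" by (intro Min_in) auto
      then obtain a where a: "Min (capacity N ` ?U) = capacity N a" "a \<in> ?U" by (rule imageE)
      have UA: "?U \<subseteq> set as" using Q(1) st st_path_subset by blast
      then obtain e where e: "e < m" "as ! e = a" using a(2) by (metis in_set_conv_nth subsetD)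
      have U: "?U \<subseteq> wide (capacity N a)"
      proof
        fix c assume c: "c \<in> ?U"
        then have "capacity N a \<le> capacity N c" unfolding a(1)[symmetric] using \<open>finite ?U\<close> by simp
        then show "c \<in> wide (capacity N a)" using c UA by (auto simp: wide_def)
      qed
      obtain k where k: "card \<Q> = Suc k" using finQ Q(2) by (metis card_gt_0_iff gr0_implies_Suc)
      have "card \<Q> \<le> card \<P>" using Q(1) P(1) by (rule card_mono[rotated])
      then have "k < p" using k P(2) by simp
      have dis: "key_disjoint \<Q>"
        unfolding key_disjoint_def pairwise_def
      proof (intro conjI ballI impI)
        show "st_path N P" if "P \<in> \<Q>" for P using that Q(1) st by blast
        fix P P' assume PP: "P \<in> \<Q>" "P' \<in> \<Q>" "P \<noteq> P'"
        then have "sep N P P'" using P(3) Q(1) unfolding pairwise_def by blast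
        then show "key ` set P \<inter> key ` set P' = {}" using sep_iff[of P P'] st PP Q(1) by blast
      qed
      have "robust k (wide (capacity N a)) {}"
        by (rule robust_of_paths[OF dis finQ]) (use k U in auto)
      then have "Suc k * capacity N a \<le> b"
        using cov \<open>k < p\<close> e unfolding covered_def by blast
      moreover have "Min (r ` \<Q>) \<le> capacity N a"
      proof -
        obtain P where "P \<in> \<Q>" "a \<in> set P" using a(2) by blast
        then show ?thesis using cap[of P a] Q(1) finQ by (meson Min_le finite_imageI imageI le_trans subsetD)
      qed
      ultimately show ?thesis unfolding k by (meson le_trans mult_le_mono2)
    qed
    have "real (\<Sum>P \<in> \<P>. r P) \<le> real b * harm (card \<P>)" by (rule sum_le_harm[OF P(1) top])
    also have "\<dots> \<le> real b * harm p" using P(2) by (intro mult_left_mono harm_mono) auto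
    finally show ?thesis unfolding val .
  qed
  have "max_flow_value (sum_of_path_flows sep p) N \<in> {flow_value N x | x. sum_of_path_flows sep p N x}"
    unfolding max_flow_value_def by (rule Max_in[OF sum_of_path_flows_values[OF net]])
  then show ?thesis using bound by auto
qed

lemma solve_approximates:
  assumes p: "p \<ge> 1" and c: "sets_key c"
  shows "\<exists>T y. computes_in_time (solve c p) (encode_network N vs as) T (map y as) \<and>
    T \<le> solve_time c p m + m \<and> sum_of_path_flows sep p N y \<and>
    real_of_int (flow_value N y) \<ge>
      1 / harm p * real_of_int (max_flow_value (sum_of_path_flows sep p) N)"
proof -
  have enc: "encode_network N vs as = encoding vs" by (simp add: encode_network_def encoding_def)
  obtain T b x where run: "computes_in_time (solve c p) (encoding vs) T (map x [0..<m])"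
    "T \<le> solve_time c p m + m" and sol: "solution p b x" and cov: "\<forall>k<p. \<forall>e<m. covered k e b"
    using solve_computes[OF c] by blast
  obtain y where y: "map y as = map x [0..<m]" "sum_of_path_flows sep p N y" "flow_value N y = int b"
    using solution_feasible[OF sol] by blast
  have "(harm p :: real) > 0" using p by (simp add: harm_pos)
  then have "1 / harm p * real_of_int (max_flow_value (sum_of_path_flows sep p) N) \<le> real b"
    using max_flow_value_le[OF cov] by (simp add: field_simps)
  then show ?thesis unfolding enc using run y by (intro exI[of _ T] exI[of _ y]) simp
qed

end

text \<open>The program is fixed, while \<open>key\<close> may depend on the network and on the
  order in which its arcs are listed.\<close>

lemma poly_time_approximationI:
  assumes p: "p \<ge> 1"
    and keyed: "\<And>N vs as. flow_network N \<Longrightarrow> network_listing N vs as \<Longrightarrow>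
      \<exists>key. keyed_network as key N sep \<and>
        arc_table.sets_key as key (snk N) c"
  shows "poly_time_approximation (1 / harm p) (sum_of_path_flows sep p) (solve c p)"
proof -
  have "polynomially_bounded (\<lambda>n. solve_time c p n + n)"
    by (intro polynomially_bounded_intros polynomially_bounded_solve_time)
  then obtain q :: "nat poly" where q: "\<And>n. solve_time c p n + n \<le> poly q n"
    unfolding polynomially_bounded_def by blast
  show ?thesis
    unfolding poly_time_approximation_def
  proof (intro exI[of _ q] allI impI)
    fix N vs as assume N: "flow_network N \<and> network_listing N vs as"
    let ?w = "encode_network N vs as"
    obtain key where key: "keyed_network as key N sep" "arc_table.sets_key as key (snk N) c"
      using keyed N by blast
    have "length as \<le> length ?w" by (simp add: encode_network_def length_concat_triples)
    \<comment> \<open>Every number contributes at least its separator to the size.\<close>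
    also have "length w \<le> input_size w" for w
      unfolding input_size_def by (induction w) auto
    finally have size: "length as \<le> input_size ?w" by simp
    obtain T y where T: "computes_in_time (solve c p) ?w T (map y as)"
      "T \<le> solve_time c p (length as) + length as" "sum_of_path_flows sep p N y"
      "real_of_int (flow_value N y) \<ge>
        1 / harm p * real_of_int (max_flow_value (sum_of_path_flows sep p) N)"
      using keyed_network.solve_approximates[OF key(1) p key(2)] by blast
    have "T \<le> poly q (input_size ?w)"
      using T(2) q poly_nat_mono[OF size] by (meson le_trans)
    then show "\<exists>T x. computes_in_time (solve c p) ?w T (map x as) \<and> T \<le> poly q (input_size ?w) \<and>
        sum_of_path_flows sep p N x \<and> 1 / harm p * real_of_int (max_flow_value (sum_of_path_flows sep p) N)
          \<le> real_of_int (flow_value N x)"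
      using T by blast
  qed
qed

section \<open>The two choices of keys\<close>

definition index_of :: "'b list \<Rightarrow> 'b \<Rightarrow> nat" where
  "index_of xs x = (THE j. j < length xs \<and> xs ! j = x)"

lemma index_of_nth: "distinct xs \<Longrightarrow> j < length xs \<Longrightarrow> index_of xs (xs ! j) = j"
  unfolding index_of_def by (rule the_equality) (auto simp: nth_eq_iff_index_eq)

lemma index_of_in_set:
  assumes "distinct xs" "x \<in> set xs"
  shows "index_of xs x < length xs" "xs ! index_of xs x = x"
  using assms by (auto simp: in_set_conv_nth index_of_nth)

lemma arc_tableI:
  assumes "flow_network N" "network_listing N vs as"
  shows "arc_table as (src N) (snk N)"
  using assms by unfold_locales (auto simp: flow_network_def network_listing_def)

lemma keyed_by_arc:
  assumes N: "flow_network N" "network_listing N vs as"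
  shows "keyed_network as (index_of as) N arc_disjoint"
    and "arc_table.sets_key as (index_of as) (snk N) key_by_arc"
proof -
  interpret arc_table as "index_of as" "capacity N" "src N" "snk N" by (rule arc_tableI[OF N])
  have inj: "a = b" if "a \<in> set as" "b \<in> set as" "index_of as a = index_of as b" for a b
    using that index_of_in_set(2)[OF distinct_arcs] by metis
  have arcs: "set as = parcs (graph_of N)" using N(2) by (simp add: network_listing_def)
  show "keyed_network as (index_of as) N arc_disjoint"
  proof unfold_locales
    show "flow_network N" "set as = parcs (graph_of N)" by fact+
    show "snd a = snd b" if "a \<in> set as" "b \<in> set as" "index_of as a = index_of as b" for a b
      using inj[OF that] by simp
    fix P Q assume "st_path N P" "st_path N Q"
    then have PQ: "set P \<subseteq> set as" "set Q \<subseteq> set as" by (auto simp: st_path_iff[OF N(1)] arcs)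
    show "arc_disjoint N P Q \<longleftrightarrow> index_of as ` set P \<inter> index_of as ` set Q = {}"
    proof
      assume "arc_disjoint N P Q"
      then have "set P \<inter> set Q = {}" by (simp add: arc_disjoint_def)
      then show "index_of as ` set P \<inter> index_of as ` set Q = {}" using PQ inj by blast
    next
      assume "index_of as ` set P \<inter> index_of as ` set Q = {}"
      then show "arc_disjoint N P Q" unfolding arc_disjoint_def by blast
    qed
  qed
  show "sets_key key_by_arc"
    using index_of_nth[OF distinct_arcs] by (simp add: sets_key_def) (simp add: key_by_arc_def)
qed

text \<open>Distinct internally disjoint paths cannot share an arc into the sink: its tail would be a common
  vertex, hence the source, and both paths would consist of this arc.\<close>

lemma keyed_by_head:
  assumes N: "flow_network N" "network_listing N vs as"
  defines "key \<equiv> \<lambda>a. if snd a = snk N then index_of as a else length as + snd a"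
  shows "keyed_network as key N internally_disjoint"
    and "arc_table.sets_key as key (snk N) key_by_head"
proof -
  interpret arc_table as key "capacity N" "src N" "snk N" by (rule arc_tableI[OF N])
  have arcs: "set as = parcs (graph_of N)" using N(2) by (simp add: network_listing_def)
  have lt: "index_of as a < m" if "a \<in> set as" for a
    by (rule index_of_in_set[OF distinct_arcs that])
  \<comment> \<open>Arc numbers are below \<open>m\<close> and keys made from heads are not, so arcs
    with equal keys either both enter the sink or both avoid it.\<close>
  have key_eq: "snd a = snd b \<and> (snd a = snk N \<longrightarrow> a = b)"
    if "a \<in> set as" "b \<in> set as" "key a = key b" for a b
  proof (cases "snd a = snk N \<and> snd b = snk N")
    case True
    then have "index_of as a = index_of as b" using that(3) by (simp add: key_def)
    then have "a = b" using index_of_in_set(2)[OF distinct_arcs] that(1,2) by metis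
    then show ?thesis by simp
  next
    case False
    then show ?thesis
      using that(3) lt[OF that(1)] lt[OF that(2)] by (simp add: key_def split: if_splits)
  qed
  show "keyed_network as key N internally_disjoint"
  proof unfold_locales
    show "flow_network N" "set as = parcs (graph_of N)" by fact+
    show "snd a = snd b" if "a \<in> set as" "b \<in> set as" "key a = key b" for a b
      using key_eq[OF that] by simp
    fix P Q assume st: "st_path N P" "st_path N Q" "P \<noteq> Q"
    have PQ: "set P \<subseteq> set as" "set Q \<subseteq> set as" "pcas (src N) P (snk N)" "pcas (src N) Q (snk N)"
      using st by (auto simp: st_path_iff[OF N(1)] arcs)
    have verts: "internally_disjoint N P Q \<longleftrightarrow>
      insert (src N) (snd ` set P) \<inter> insert (src N) (snd ` set Q) = {src N, snk N}"
      unfolding internally_disjoint_def awalk_verts_with_proj_eq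
      by (simp only: set_pawalk_verts[OF PQ(3)] set_pawalk_verts[OF PQ(4)])
    have snk: "snk N \<in> snd ` set P" "snk N \<in> snd ` set Q"
      using pcas_ends[OF PQ(3)] pcas_ends[OF PQ(4)] st_path_not_Nil[OF N(1)] st
      by (metis imageI last_in_set)+
    show "internally_disjoint N P Q \<longleftrightarrow> key ` set P \<inter> key ` set Q = {}"
    proof
      assume dis: "key ` set P \<inter> key ` set Q = {}"
      have "v = snk N" if "v \<in> snd ` set P" "v \<in> snd ` set Q" for v
      proof (rule ccontr)
        assume "v \<noteq> snk N"
        then have "length as + v \<in> key ` set P" "length as + v \<in> key ` set Q"
          using that by (force simp: key_def image_iff)+
        then show False using dis by blast
      qed
      moreover have "src N \<notin> snd ` set P" "src N \<notin> snd ` set Q"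
        using st_path_snd_neq_src[OF N(1)] st by force+
      ultimately show "internally_disjoint N P Q" unfolding verts using snk by blast
    next
      assume "internally_disjoint N P Q"
      then have dis: "insert (src N) (snd ` set P) \<inter> insert (src N) (snd ` set Q) = {src N, snk N}"
        by (simp only: verts)
      show "key ` set P \<inter> key ` set Q = {}"
      proof (rule ccontr)
        assume "key ` set P \<inter> key ` set Q \<noteq> {}"
        then obtain a b where ab: "a \<in> set P" "b \<in> set Q" "key a = key b" by force
        have "a \<in> set as" "b \<in> set as" using ab(1,2) PQ(1,2) by (auto dest: subsetD)
        from key_eq[OF this ab(3)] have eq: "snd a = snd b" "snd a = snk N \<longrightarrow> a = b"
          by (rule conjunct1, rule conjunct2)
        have "snd a \<in> snd ` set P" using ab(1) by (rule imageI)
        moreover have "snd a \<in> snd ` set Q" unfolding eq(1) using ab(2) by (rule imageI)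
        ultimately have "snd a \<in> {src N, snk N}" using dis by blast
        moreover have "snd a \<noteq> src N" using st_path_snd_neq_src[OF N(1) st(1) ab(1)] .
        ultimately have snd: "snd a = snk N" "a = b" using eq(2) by simp_all
        have "fst a \<in> insert (src N) (snd ` set P)" "fst a \<in> insert (src N) (snd ` set Q)"
          using fst_in_pawalk_verts[of a P "src N"] fst_in_pawalk_verts[of a Q "src N"] ab snd(2)
          by (simp_all only: set_pawalk_verts[OF PQ(3)] set_pawalk_verts[OF PQ(4)])
        then have fst: "fst a \<in> {src N, snk N}" using dis by blast
        \<comment> \<open>An arc out of the source can only be the first arc of a path. This one
          ends in the sink, and any continuation would have to return there and repeat a
          vertex.\<close>
        have single: "R = [a]" if R: "st_path N R" "a \<in> set R" "fst a = src N" for R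
        proof -
          have pc: "pcas (src N) R (snk N)" and d: "distinct (pawalk_verts (src N) R)"
            using R(1) by (auto simp: st_path_iff[OF N(1)])
          obtain c R' where R': "R = c # R'" using R(2) by (cases R) auto
          have "a \<notin> set R'" using d R(3) R' fst_in_pawalk_verts[of a R' "snd c"] pc by auto
          then have "c = a" using R(2) R' by simp
          moreover have "R' = []"
          proof (rule ccontr)
            assume ne: "R' \<noteq> []"
            have pc': "pcas (snk N) R' (snk N)" using pc R' \<open>c = a\<close> snd(1) by simp
            have "snd (last R') = snk N" using pcas_ends[OF pc' ne] by simp
            then have "snk N \<in> set (tl (pawalk_verts (snk N) R'))"
              using snd_in_pawalk_verts[OF last_in_set[OF ne] pc'] by simp
            moreover have "distinct (pawalk_verts (snk N) R')" using d R' \<open>c = a\<close> snd(1) by simp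
            ultimately show False using ne by (cases R') (use pc' in auto)
          qed
          ultimately show ?thesis using R' by simp
        qed
        have "fst a \<noteq> snk N"
        proof
          assume loop: "fst a = snk N"
          interpret G: pair_digraph "graph_of N" using N(1) by (simp add: flow_network_def)
          have "a \<in> parcs (graph_of N)" using ab(1) PQ(1) arcs by blast
          then have "fst a \<noteq> snd a" by (rule G.pair_no_loops)
          then show False using loop snd(1) by simp
        qed
        with fst have "fst a = src N" by blast
        then have "P = [a]" "Q = [a]" using single[OF st(1)] single[OF st(2)] ab(1,2) snd(2) by simp_all
        then show False using st(3) by simp
      qed
    qed
  qed
  have "straight key_by_head \<rho> ''k'' = (\<rho> ''k'')(j := key (as ! j))"
    if "j < m" "\<rho> ''l'' 0 = j" "\<rho> ''v'' j = snd (as ! j)" "\<rho> ''m'' 0 = m" "\<rho> ''t'' 0 = snk N" for \<rho> j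
  proof -
    have "snd (as ! j) - snk N + (snk N - snd (as ! j)) = 0 \<longleftrightarrow> snd (as ! j) = snk N" by arith
    then have test: "eval_expr (Add (Sub (item ''v'' ''l'') (var ''t''))
      (Sub (var ''t'') (item ''v'' ''l''))) \<rho> = 0 \<longleftrightarrow> snd (as ! j) = snk N"
      using that by simp
    show ?thesis
    proof (cases "snd (as ! j) = snk N")
      case True
      then have "straight key_by_head \<rho> = upd ''k'' j j \<rho>"
        using test that(2) unfolding key_by_head_def straight.simps by simp
      then show ?thesis using True index_of_nth[OF distinct_arcs that(1)] by (simp add: key_def)
    next
      case False
      then have "straight key_by_head \<rho> = upd ''k'' j (m + snd (as ! j)) \<rho>"
        using test that(2-4) unfolding key_by_head_def straight.simps by simp
      then show ?thesis using False by (simp add: key_def)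
    qed
  qed
  moreover have "writes key_by_head = {''k''}" by (simp add: key_by_head_def)
  ultimately show "sets_key key_by_head" by (simp add: sets_key_def)
qed

theorem theorem6p4:
  fixes p :: nat
  assumes "p \<ge> 1"
  shows "(\<exists>prog. poly_time_approximation (1 / harm p) (sum_of_path_flows arc_disjoint p) prog) \<and>
         (\<exists>prog. poly_time_approximation (1 / harm p) (sum_of_path_flows internally_disjoint p) prog)"
proof (intro conjI exI)
  show "poly_time_approximation (1 / harm p) (sum_of_path_flows arc_disjoint p) (solve key_by_arc p)"
    using keyed_by_arc by (intro poly_time_approximationI[OF assms]) blast
  show "poly_time_approximation (1 / harm p) (sum_of_path_flows internally_disjoint p)
      (solve key_by_head p)"
    using keyed_by_head by (intro poly_time_approximationI[OF assms]) blast
qed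

end
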